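(* Let $p\ge3$, let $\alpha=(\alpha_1,\dots,\alpha_{p-1})\in\mathbb N^{p-1}\setminus\{0\}$ with $\gcd(\alpha_1,\dots,\alpha_{p-1})=1$, and assume no edge of $C_p^*$ is contained in the hyperplane $\{x:\alpha\cdot x=0\}$. Let $S$ be a $d$-dimensional face of $C_p$ with closure $\bar S$, let $S^*=S-v$ be the face of $C_p^*$ parallel to $S$, let $\delta_1,\dots,\delta_t$ be the canonical system of representatives for the edges of $C_p^*$, and let $\delta_1,\dots,\delta_r$ be those lying in the closure of $S^*$. For $n\in\mathbb N$ let $H_n=\{x\in\mathbb R^{p-1}:\alpha\cdot x=n\}$, let $f_\alpha^{\bar S}(n)$, $f_\alpha(n)$ and $f_\alpha^0(n)$ be the numbers of points of $\mathbb N^{p-1}$ in $H_n\cap\bar S$, $H_n\cap C_p$ and $H_n\cap C_p^0$ respectively, where $C_p^0$ is the interior of $C_p$. If $\bar S$ contains a point $u\in\mathbb N^{p-1}$, then $f_\alpha^{\bar S}$ is a quasi-polynomial of degree $d-1$ with non-negative leading coefficient, and the least common multiple of $\alpha\cdot\delta_1,\dots,\alpha\cdot\delta_r$ is a quasi-period of $f_\alpha^{\bar S}$. In particular $f_\alpha$ is a quasi-polynomial of degree $p-2$. Moreover, for $n\ge\sum_{i=1}^{p-1}\alpha_i$ one has $f_\alpha^0(n)=f_\alpha\big(n-\sum_{i=1}^{p-1}\alpha_i\big)$.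
   Context: For an integer $p\ge3$, $C_p\subset\mathbb R^{p-1}$ is the solution set of $X_i+X_j\ge X_{i+j}$ ($i+j<p$) and $X_i+X_j\ge X_{i+j-p}-1$ ($i+j>p$), $i,j\in\{1,\dots,p-1\}$; it is a $(p-1)$-dimensional polyhedral cone with vertex $v=(-\frac1p,\dots,-\frac{p-1}p)$. $C_p^*:=-v+C_p$ is a polyhedral cone with vertex $0$ contained in $\mathbb R_{\ge0}^{p-1}$. Faces are open (relatively open) faces; the interior and the vertex also count as faces; the dimension of a face is that of its affine hull. Edges are the 1-dimensional faces of $C_p^*$ (open rays from $0$); on each edge there is a unique primitive lattice point (integral coordinates with gcd 1), and the set of these points is the canonical system of representatives for the edges. A function $f:\mathbb N\to\mathbb C$ is a quasi-polynomial of degree $d$ and quasi-period $N>0$ if $f(n)=c_d(n)n^d+\dots+c_0(n)$ for all $n$, with functions $c_k:\mathbb N\to\mathbb C$ periodic of period $N$ and $c_d$ not identically zero; $c_d$ is the leading coefficient. The zero function is also regarded as a quasi-polynomial. *)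

theory Defs
  imports "HOL-Analysis.Analysis"
begin

text \<open>
  The space of dimension \<open>p - 1\<close> is \<open>real ^ 'n\<close>, and a bijection \<open>lab\<close> from \<open>{1..<p}\<close> onto \<open>'n\<close>
  names its coordinates: \<open>x $ lab i\<close> is the coordinate \<open>X\<^sub>i\<close>.
\<close>

definition kunz_cone :: "nat \<Rightarrow> (nat \<Rightarrow> 'n::finite) \<Rightarrow> (real ^ 'n) set" where
  "kunz_cone p lab = {x. \<forall>i\<in>{1..<p}. \<forall>j\<in>{1..<p}.
     (i + j < p \<longrightarrow> x $ lab i + x $ lab j \<ge> x $ lab (i + j)) \<and>
     (i + j > p \<longrightarrow> x $ lab i + x $ lab j \<ge> x $ lab (i + j - p) - 1)}"

definition kunz_vertex :: "nat \<Rightarrow> (nat \<Rightarrow> 'n::finite) \<Rightarrow> real ^ 'n" where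
  "kunz_vertex p lab = (\<chi> k. - real (the_inv_into {1..<p} lab k) / real p)"

definition shift_to_origin :: "nat \<Rightarrow> (nat \<Rightarrow> 'n::finite) \<Rightarrow> (real ^ 'n) set \<Rightarrow> (real ^ 'n) set" where
  "shift_to_origin p lab A = (\<lambda>x. x - kunz_vertex p lab) ` A"

abbreviation kunz_cone_star :: "nat \<Rightarrow> (nat \<Rightarrow> 'n::finite) \<Rightarrow> (real ^ 'n) set" where
  "kunz_cone_star p lab \<equiv> shift_to_origin p lab (kunz_cone p lab)"

text \<open>
  The faces in the sense of \<open>face_of\<close> are closed for a polyhedron; the faces used here are their
  relative interiors.  Since \<open>C face_of C\<close>, the relative interior of \<open>C\<close> itself is included.
\<close>

definition open_face_of :: "'a::euclidean_space set \<Rightarrow> 'a set \<Rightarrow> bool" (infix "open'_face'_of" 50) where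
  "S open_face_of C \<longleftrightarrow> (\<exists>F. F face_of C \<and> F \<noteq> {} \<and> S = rel_interior F)"

definition open_edge_of :: "'a::euclidean_space set \<Rightarrow> 'a set \<Rightarrow> bool" (infix "open'_edge'_of" 50) where
  "E open_edge_of C \<longleftrightarrow> E open_face_of C \<and> aff_dim E = 1"

definition real_vec :: "int ^ 'n \<Rightarrow> real ^ 'n" where
  "real_vec z = (\<chi> k. real_of_int (z $ k))"

definition edge_representatives :: "(real ^ 'n::finite) set \<Rightarrow> (int ^ 'n) set" where
  "edge_representatives C =
     {z. Gcd (range (\<lambda>k. z $ k)) = 1 \<and> (\<exists>E. E open_edge_of C \<and> real_vec z \<in> E)}"

definition weight_hyperplane :: "nat ^ 'n::finite \<Rightarrow> nat \<Rightarrow> (real ^ 'n) set" where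
  "weight_hyperplane \<alpha> n = {x. (\<Sum>k\<in>UNIV. real (\<alpha> $ k) * x $ k) = real n}"

definition nat_points :: "(real ^ 'n::finite) set" where
  "nat_points = {x. \<forall>k. x $ k \<in> \<nat>}"

definition slice_count :: "nat ^ 'n::finite \<Rightarrow> (real ^ 'n) set \<Rightarrow> nat \<Rightarrow> nat" where
  "slice_count \<alpha> A n = card (nat_points \<inter> weight_hyperplane \<alpha> n \<inter> A)"

definition face_quasi_period ::
    "nat \<Rightarrow> (nat \<Rightarrow> 'n::finite) \<Rightarrow> nat ^ 'n \<Rightarrow> (real ^ 'n) set \<Rightarrow> nat" where
  "face_quasi_period p lab \<alpha> S =
     nat (Lcm ((\<lambda>\<delta>. \<Sum>k\<in>UNIV. int (\<alpha> $ k) * \<delta> $ k) `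
       {\<delta> \<in> edge_representatives (kunz_cone_star p lab).
          real_vec \<delta> \<in> closure (shift_to_origin p lab S)}))"

definition quasi_polynomial_coeffs ::
    "(nat \<Rightarrow> complex) \<Rightarrow> nat \<Rightarrow> nat \<Rightarrow> (nat \<Rightarrow> nat \<Rightarrow> complex) \<Rightarrow> bool" where
  "quasi_polynomial_coeffs f d N c \<longleftrightarrow>
     N > 0 \<and> (\<forall>k\<le>d. \<forall>n. c k (n + N) = c k n) \<and> (\<exists>n. c d n \<noteq> 0) \<and>
     (\<forall>n. f n = (\<Sum>k\<le>d. c k n * of_nat n ^ k))"

end

theory Submission
  imports Defs
begin

text \<open>
  A closed face of the shifted cone is generated by the primitive vectors of its edges.  After
  rescaling them to have the same weight \<open>N\<close>, the least common multiple of their weights, the face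
  is a disjoint union of relatively open simplicial cones on linearly independent sets of generators.
  A point of such an open cone is uniquely a point of the half-open box with coefficients in
  \<open>(0, 1]\<close> plus a natural combination of the generators, so each box point \<open>w\<close> contributes a binomial
  coefficient in \<open>(n - b) / N\<close>, with \<open>b\<close> the weight of \<open>w\<close>, on one residue class modulo \<open>N\<close>.
  Because the vertex has negative weight, \<open>b\<close> is so small that this formula holds for all \<open>n \<ge> 0\<close>.
  Integral points of the interior correspond to integral points of the cone under \<open>x \<mapsto> x - 1\<close>, where
  \<open>1\<close> is the vector with all coordinates one, since a strict integral inequality gains one unit.
\<close>

section \<open>Simplicial decomposition of cones\<close>

text \<open>Two things must come out exactly: the period has to be the least common multiple itself,
  and the formula has to hold from \<open>n = 0\<close> on. Equal weights give the first, since
  adding any generator raises the weight by the same \<open>N\<close>. The second rests on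
  \<open>a \<bullet> q < 0\<close> for the vertex \<open>q\<close>: it makes
  \<open>b < N (e + 1)\<close> strict, and the binomial polynomial vanishes at the negative
  arguments that remain. The pieces bound only the degree; that the top coefficient is not
  identically zero follows from a growth estimate starting at the given lattice point. Before this,
  the generators must be known to be integral. The normals of the cone are integral, but its extreme
  rays come from a compactness argument and are real vectors, so their rationality needs a proof.
  The hypothesis on edges makes all generators have positive weight, which bounds the
  slices.\<close>

definition open_cone :: "'a::real_vector set \<Rightarrow> 'a set" where
  "open_cone I = {\<Sum>i\<in>I. l i *\<^sub>R i | l. \<forall>i\<in>I. 0 < l i}"

lemma sum_in_convex_cone_hull:
  assumes "J \<subseteq> D" "\<And>i. i \<in> J \<Longrightarrow> 0 \<le> l i"
  shows "(\<Sum>i\<in>J. l i *\<^sub>R i) \<in> convex_cone hull D"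
  using assms
proof (induction J rule: infinite_finite_induct)
  case (insert i J)
  then have "l i *\<^sub>R i \<in> convex_cone hull D"
    by (intro convex_cone_hull_mul hull_inc) auto
  moreover have "(\<Sum>i\<in>J. l i *\<^sub>R i) \<in> convex_cone hull D"
    using insert by auto
  ultimately show ?case
    using insert by (simp add: convex_cone_hull_add)
qed (simp_all add: convex_cone_hull_contains_0)

lemma open_cone_insert:
  assumes "finite I" "d \<notin> I"
  shows "open_cone (insert d I) = {t *\<^sub>R d + y | t y. 0 < t \<and> y \<in> open_cone I}"
proof -
  have "x \<in> open_cone (insert d I)" if "0 < t" "y \<in> open_cone I" "x = t *\<^sub>R d + y" for t x y
  proof -
    obtain l where l: "y = (\<Sum>i\<in>I. l i *\<^sub>R i)" "\<forall>i\<in>I. 0 < l i"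
      using \<open>y \<in> open_cone I\<close> by (auto simp: open_cone_def)
    have "(\<Sum>i\<in>I. (l(d := t)) i *\<^sub>R i) = y"
      unfolding l(1) using assms by (intro sum.cong) auto
    then have "x = (\<Sum>i\<in>insert d I. (l(d := t)) i *\<^sub>R i)"
      using assms that by simp
    moreover have "\<forall>i\<in>insert d I. 0 < (l(d := t)) i"
      using l that by auto
    ultimately show ?thesis
      unfolding open_cone_def by blast
  qed
  moreover have "\<exists>t y. x = t *\<^sub>R d + y \<and> 0 < t \<and> y \<in> open_cone I" if "x \<in> open_cone (insert d I)" for x
    using that assms by (auto simp: open_cone_def)
  ultimately show ?thesis
    by blast
qed

lemma convex_cone_hull_insert:
  "convex_cone hull (insert d D) = {t *\<^sub>R d + y | t y. 0 \<le> t \<and> y \<in> convex_cone hull D}"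
proof -
  have "convex_cone hull {d} = {t *\<^sub>R d | t. 0 \<le> t}"
    by (auto simp: convex_cone_hull_convex_hull intro: exI[of _ 0])
  then show ?thesis
    using convex_cone_hull_Un[of "{d}" D] by auto
qed

text \<open>A relatively open cone leaves room to retreat from \<open>z\<close> in the direction of
  any of its points. This carries maximality of the coefficient of a new generator from one point of
  a piece to all others.\<close>

lemma open_cone_diff_multiple:
  assumes "finite I" "y \<in> open_cone I" "z \<in> open_cone I"
  obtains c where "0 < c" "z - c *\<^sub>R y \<in> open_cone I"
proof -
  obtain l m where l: "y = (\<Sum>i\<in>I. l i *\<^sub>R i)" "\<forall>i\<in>I. 0 < l i"
    and m: "z = (\<Sum>i\<in>I. m i *\<^sub>R i)" "\<forall>i\<in>I. 0 < m i"
    using assms by (auto simp: open_cone_def)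
  define c where "c = Min (insert 1 ((\<lambda>i. m i / (2 * l i)) ` I))"
  have "0 < c"
    unfolding c_def using assms(1) l m by auto
  have "c * l i < m i" if "i \<in> I" for i
  proof -
    have "c \<le> m i / (2 * l i)"
      unfolding c_def using assms(1) that by auto
    then have "c * l i \<le> m i / 2"
      using l that by (auto simp: field_simps)
    moreover have "0 < m i"
      using m that by auto
    ultimately show ?thesis by linarith
  qed
  moreover have "z - c *\<^sub>R y = (\<Sum>i\<in>I. (m i - c * l i) *\<^sub>R i)"
    by (simp add: l m scaleR_sum_right sum_subtractf algebra_simps)
  ultimately have "z - c *\<^sub>R y \<in> open_cone I"
    unfolding open_cone_def by (auto intro!: exI[of _ "\<lambda>i. m i - c * l i"])
  with \<open>0 < c\<close> that show thesis by blast
qed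

text \<open>An open cone is open in its span, so one can step back along \<open>d\<close> even if
  the coefficients of \<open>d\<close> have mixed signs. This forces a new generator out of the span
  of every piece on which its coefficient is maximal.\<close>

lemma open_cone_diff_span:
  assumes "finite I" "y \<in> open_cone I" "d \<in> span I"
  obtains e where "0 < e" "y - e *\<^sub>R d \<in> open_cone I"
proof -
  obtain l where l: "y = (\<Sum>i\<in>I. l i *\<^sub>R i)" "\<forall>i\<in>I. 0 < l i"
    using assms by (auto simp: open_cone_def)
  obtain b where b: "d = (\<Sum>i\<in>I. b i *\<^sub>R i)"
    using assms(1,3) by (auto simp: span_finite)
  define e where "e = Min (insert 1 ((\<lambda>i. l i / (2 * (1 + \<bar>b i\<bar>))) ` I))"
  have "0 < e"
    unfolding e_def using assms(1) l by (auto intro!: divide_pos_pos mult_pos_pos add_pos_nonneg)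
  have "e * b i < l i" if "i \<in> I" for i
  proof -
    have "e \<le> l i / (2 * (1 + \<bar>b i\<bar>))"
      unfolding e_def using assms(1) that by auto
    then have "e * (1 + \<bar>b i\<bar>) \<le> l i / 2"
      by (auto simp: field_simps)
    moreover have "e * b i \<le> e * (1 + \<bar>b i\<bar>)"
      using \<open>0 < e\<close> by (intro mult_left_mono) auto
    moreover have "0 < l i"
      using l that by auto
    ultimately show ?thesis by linarith
  qed
  moreover have "y - e *\<^sub>R d = (\<Sum>i\<in>I. (l i - e * b i) *\<^sub>R i)"
    by (simp add: l b scaleR_sum_right sum_subtractf algebra_simps)
  ultimately have "y - e *\<^sub>R d \<in> open_cone I"
    unfolding open_cone_def by (auto intro!: exI[of _ "\<lambda>i. l i - e * b i"])
  with \<open>0 < e\<close> that show thesis by blast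
qed

lemma convex_cone_hull_inner_nonneg:
  assumes "\<And>d. d \<in> D \<Longrightarrow> 0 \<le> a \<bullet> d" "x \<in> convex_cone hull D"
  shows "0 \<le> a \<bullet> x"
proof -
  have "convex_cone hull D \<subseteq> {x. 0 \<le> a \<bullet> x}"
    using assms(1) by (intro hull_minimal convex_cone_halfspace_ge) auto
  then show ?thesis using assms(2) by auto
qed

lemma convex_cone_hull_scaleR:
  assumes "\<And>z. z \<in> Z \<Longrightarrow> 0 < c z"
  shows "convex_cone hull ((\<lambda>z. c z *\<^sub>R g z) ` Z) = convex_cone hull (g ` Z)"
proof
  show "convex_cone hull ((\<lambda>z. c z *\<^sub>R g z) ` Z) \<subseteq> convex_cone hull (g ` Z)"
  proof (rule hull_minimal)
    show "(\<lambda>z. c z *\<^sub>R g z) ` Z \<subseteq> convex_cone hull (g ` Z)"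
    proof safe
      fix z assume z: "z \<in> Z"
      then have "g z \<in> convex_cone hull (g ` Z)"
        by (intro hull_inc) auto
      then show "c z *\<^sub>R g z \<in> convex_cone hull (g ` Z)"
        using assms[OF z] by (simp add: convex_cone_hull_mul)
    qed
  qed (rule convex_cone_convex_cone_hull)
  show "convex_cone hull (g ` Z) \<subseteq> convex_cone hull ((\<lambda>z. c z *\<^sub>R g z) ` Z)"
  proof (rule hull_minimal)
    show "g ` Z \<subseteq> convex_cone hull ((\<lambda>z. c z *\<^sub>R g z) ` Z)"
    proof safe
      fix z assume z: "z \<in> Z"
      then have "c z *\<^sub>R g z \<in> convex_cone hull ((\<lambda>z. c z *\<^sub>R g z) ` Z)"
        by (intro hull_inc) auto
      then have "(1 / c z) *\<^sub>R c z *\<^sub>R g z \<in> convex_cone hull ((\<lambda>z. c z *\<^sub>R g z) ` Z)"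
        using assms[OF z] by (simp only: convex_cone_hull_mul zero_le_divide_1_iff less_imp_le)
      then show "g z \<in> convex_cone hull ((\<lambda>z. c z *\<^sub>R g z) ` Z)"
        using assms[OF z] by simp
    qed
  qed (rule convex_cone_convex_cone_hull)
qed

lemma dim_convex_cone_hull: "dim (convex_cone hull D) = dim D"
proof -
  have "convex_cone hull D \<subseteq> span D"
    by (rule hull_minimal) (auto simp: span_superset convex_cone_span)
  then have "span (convex_cone hull D) = span D"
    by (meson hull_subset span_minimal span_mono subset_antisym subspace_span)
  then show ?thesis
    by (metis dim_span)
qed

text \<open>
  Pulling at a new generator \<open>d\<close>: a point of the larger cone is written as \<open>t d + y\<close> with \<open>t\<close> as
  large as possible.  Whether \<open>t\<close> is maximal depends only on the open cone that contains \<open>y\<close>.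
\<close>

lemma simplicial_decomposition_of_cone:
  fixes D :: "'a::euclidean_space set"
  assumes "finite D" "\<And>d. d \<in> D \<Longrightarrow> 0 < a \<bullet> d"
  obtains G where "G \<subseteq> Pow D" "\<And>I. I \<in> G \<Longrightarrow> independent I"
    "disjoint_family_on open_cone G" "convex_cone hull D = (\<Union>I\<in>G. open_cone I)"
proof -
  have "\<exists>G. G \<subseteq> Pow D \<and> (\<forall>I\<in>G. independent I) \<and>
      disjoint_family_on open_cone G \<and> convex_cone hull D = (\<Union>I\<in>G. open_cone I)"
    using assms
  proof (induction D rule: finite_induct)
    case empty
    have "convex_cone hull {} = (\<Union>I\<in>{{}}. open_cone I :: 'a set)"
      by (simp add: open_cone_def)
    then show ?case
      by (intro exI[of _ "{{}}"]) (auto simp: disjoint_family_on_def independent_empty)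
  next
    case (insert d D)
    define K where "K = convex_cone hull D"
    obtain G where G: "G \<subseteq> Pow D" "\<And>I. I \<in> G \<Longrightarrow> independent I"
      "disjoint_family_on open_cone G" "K = (\<Union>I\<in>G. open_cone I)"
      using insert unfolding K_def by auto
    have fin: "finite I" and dI: "d \<notin> I" if "I \<in> G" for I
      using G(1) that insert by (auto intro: finite_subset)
    have ad: "0 < a \<bullet> d" and aD: "\<And>x. x \<in> K \<Longrightarrow> 0 \<le> a \<bullet> x"
      using insert.prems convex_cone_hull_inner_nonneg[of D a] unfolding K_def
      by (force intro: less_imp_le)+
    \<comment> \<open>\<open>P y\<close> says that no positive multiple of \<open>d\<close> can be
      split off \<open>y\<close> inside \<open>K\<close>; in \<open>x = t d + y\<close> the
      coefficient \<open>t\<close> is then maximal.\<close>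
    define P where "P y \<longleftrightarrow> (\<forall>e>0. y - e *\<^sub>R d \<notin> K)" for y
    have K: "x + y \<in> K" "0 \<le> c \<Longrightarrow> c *\<^sub>R x \<in> K" if "x \<in> K" "y \<in> K" for x y c
      using that unfolding K_def by (simp_all add: convex_cone_hull_add convex_cone_hull_mul)
    \<comment> \<open>If \<open>z\<close> could shed \<open>e d\<close>, then
      \<open>y = (y - c z) + c z\<close>, with first summand in \<open>K\<close>, could shed
      \<open>c e d\<close>.\<close>
    have P_open: "P z" if Iyz: "I \<in> G" "y \<in> open_cone I" "z \<in> open_cone I" "P y" for I y z
    proof -
      obtain c where c: "0 < c" "y - c *\<^sub>R z \<in> open_cone I"
        using open_cone_diff_multiple[OF fin[OF Iyz(1)] Iyz(3,2)] by blast
      then have "y - c *\<^sub>R z \<in> K"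
        using G that by auto
      moreover have "z - e *\<^sub>R d \<in> K \<Longrightarrow> (y - c *\<^sub>R z) + c *\<^sub>R (z - e *\<^sub>R d) \<in> K" for e
        using calculation c K by auto
      moreover have "(y - c *\<^sub>R z) + c *\<^sub>R (z - e *\<^sub>R d) = y - (c * e) *\<^sub>R d" for e
        by (simp add: algebra_simps)
      ultimately show ?thesis
        using \<open>P y\<close> c unfolding P_def by (metis mult_pos_pos)
    qed
    have unique: "s = t \<and> y = z" if "P y" "P z" "y \<in> K" "z \<in> K" "s *\<^sub>R d + y = t *\<^sub>R d + z" for s t y z
    proof -
      have "z = y - (t - s) *\<^sub>R d" "y = z - (s - t) *\<^sub>R d"
        using that(5) by (auto simp: algebra_simps)
      then have "\<not> 0 < t - s" "\<not> 0 < s - t"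
        using that unfolding P_def by metis+
      then show ?thesis using that by auto
    qed
    have ex: "\<exists>t\<ge>0. \<exists>y\<in>K. P y \<and> x = t *\<^sub>R d + y" if x: "x \<in> convex_cone hull (insert d D)" for x
    proof -
      \<comment> \<open>Admissible coefficients of \<open>d\<close>: bounded because
        \<open>a\<close> is positive on \<open>d\<close> and non-negative on \<open>K\<close>,
        closed because a finitely generated cone is closed. So a largest one exists.\<close>
      define T where "T = {t. 0 \<le> t \<and> x - t *\<^sub>R d \<in> K}"
      have "T \<noteq> {}"
        using x unfolding T_def convex_cone_hull_insert K_def by (auto simp: algebra_simps)
      moreover have "bounded T"
      proof -
        have "t \<le> (a \<bullet> x) / (a \<bullet> d)" if "t \<in> T" for t
          using aD[of "x - t *\<^sub>R d"] that ad by (simp add: T_def inner_simps field_simps)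
        then have "T \<subseteq> {0..(a \<bullet> x) / (a \<bullet> d)}"
          by (auto simp: T_def)
        then show ?thesis
          using bounded_closed_interval bounded_subset by blast
      qed
      moreover have "closed T"
      proof -
        have "closed K"
          unfolding K_def using insert by (intro closed_convex_cone_hull) auto
        then have "closed ((\<lambda>t. x - t *\<^sub>R d) -` K)"
          by (intro closed_vimage continuous_intros)
        moreover have "T = {0..} \<inter> (\<lambda>t. x - t *\<^sub>R d) -` K"
          by (auto simp: T_def)
        ultimately show ?thesis by auto
      qed
      ultimately obtain t where t: "t \<in> T" "\<And>s. s \<in> T \<Longrightarrow> s \<le> t"
        using compact_attains_sup[of T] by (auto simp: compact_eq_bounded_closed)
      have "P (x - t *\<^sub>R d)"
        unfolding P_def
      proof safe
        fix e :: real assume e: "0 < e" "x - t *\<^sub>R d - e *\<^sub>R d \<in> K"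
        then have "t + e \<in> T"
          using t by (auto simp: T_def algebra_simps)
        then show False
          using t e by fastforce
      qed
      then show ?thesis
        using t by (intro exI[of _ t] conjI bexI[of _ "x - t *\<^sub>R d"]) (auto simp: T_def)
    qed
    \<comment> \<open>By \<open>P_open\<close>, \<open>P\<close> holds on a whole old piece or
      nowhere on it. The kept pieces stand for \<open>t = 0\<close>, their extensions by
      \<open>d\<close> for \<open>t > 0\<close>.\<close>
    define G0 where "G0 = {I \<in> G. \<forall>y\<in>open_cone I. P y}"
    define G' where "G' = G0 \<union> insert d ` G0"
    have P_G0: "I \<in> G0" if "I \<in> G" "y \<in> open_cone I" "P y" for I y
      using P_open that unfolding G0_def by blast
    have mem_open: "\<exists>J\<in>G0. \<exists>t\<ge>0. \<exists>y\<in>open_cone J. x = t *\<^sub>R d + y \<and> I = (if t = 0 then J else insert d J)"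
      if "I \<in> G'" and x: "x \<in> open_cone I" for I x
      using that(1) unfolding G'_def
    proof
      assume "I \<in> G0"
      then show ?thesis using x by (intro bexI[of _ I] exI[of _ 0]) auto
    next
      assume "I \<in> insert d ` G0"
      then obtain J where J: "J \<in> G0" "I = insert d J" by auto
      then obtain t y where "0 < t" "y \<in> open_cone J" "x = t *\<^sub>R d + y"
        using x open_cone_insert[of J d] fin dI unfolding G0_def by auto
      then show ?thesis using J by (intro bexI[of _ J] exI[of _ t]) auto
    qed
    have "disjoint_family_on open_cone G'"
      unfolding disjoint_family_on_def
    proof (intro ballI impI, rule ccontr)
      fix I1 I2 assume I: "I1 \<in> G'" "I2 \<in> G'" "I1 \<noteq> I2" "open_cone I1 \<inter> open_cone I2 \<noteq> {}"
      then obtain x where x: "x \<in> open_cone I1" "x \<in> open_cone I2" by blast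
      obtain J1 t1 y1 where
        1: "J1 \<in> G0" "y1 \<in> open_cone J1" "x = t1 *\<^sub>R d + y1" "I1 = (if t1 = 0 then J1 else insert d J1)"
        using mem_open[OF I(1) x(1)] by blast
      obtain J2 t2 y2 where
        2: "J2 \<in> G0" "y2 \<in> open_cone J2" "x = t2 *\<^sub>R d + y2" "I2 = (if t2 = 0 then J2 else insert d J2)"
        using mem_open[OF I(2) x(2)] by blast
      have "J1 \<in> G" "J2 \<in> G" "P y1" "P y2"
        using 1 2 by (auto simp: G0_def)
      moreover from this have "y1 \<in> K" "y2 \<in> K"
        using 1(2) 2(2) G(4) by blast+
      ultimately have "t1 = t2" "y1 = y2"
        using unique[of y1 y2 t1 t2] 1(3) 2(3) by simp_all
      moreover from this have "J1 = J2"
        using \<open>J1 \<in> G\<close> \<open>J2 \<in> G\<close> 1(2) 2(2) G(3) unfolding disjoint_family_on_def by blast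
      ultimately show False
        using 1(4) 2(4) I(3) by auto
    qed
    moreover have "convex_cone hull (insert d D) = (\<Union>I\<in>G'. open_cone I)"
    proof (intro equalityI subsetI)
      fix x assume "x \<in> convex_cone hull (insert d D)"
      then obtain t y I where ty: "t \<ge> 0" "P y" "x = t *\<^sub>R d + y" "I \<in> G" "y \<in> open_cone I"
        using ex G by blast
      then have "I \<in> G0" using P_G0 by auto
      show "x \<in> (\<Union>I\<in>G'. open_cone I)"
      proof (cases "t = 0")
        case True
        then show ?thesis using ty \<open>I \<in> G0\<close> by (auto simp: G'_def)
      next
        case False
        then have "x \<in> open_cone (insert d I)"
          using ty(1,3,5) fin[OF ty(4)] dI[OF ty(4)] open_cone_insert by fastforce
        then show ?thesis using \<open>I \<in> G0\<close> by (auto simp: G'_def)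
      qed
    next
      fix x assume "x \<in> (\<Union>I\<in>G'. open_cone I)"
      then obtain J t y where "J \<in> G0" "t \<ge> 0" "y \<in> open_cone J" "x = t *\<^sub>R d + y"
        using mem_open by blast
      then show "x \<in> convex_cone hull (insert d D)"
        using G(4) unfolding convex_cone_hull_insert G0_def K_def by blast
    qed
    moreover have "independent I" if "I \<in> G'" for I
      using that unfolding G'_def
    proof
      assume "I \<in> insert d ` G0"
      then obtain J where J: "J \<in> G0" "I = insert d J" by auto
      \<comment> \<open>Otherwise a small multiple of \<open>d\<close> could be subtracted within
        the open cone of \<open>J\<close>, against \<open>P\<close> there.\<close>
      have "d \<notin> span J"
      proof
        assume "d \<in> span J"
        moreover have y: "(\<Sum>i\<in>J. 1 *\<^sub>R i) \<in> open_cone J"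
          unfolding open_cone_def by (auto intro!: exI[of _ "\<lambda>_. 1"])
        ultimately obtain e where "0 < e" "(\<Sum>i\<in>J. 1 *\<^sub>R i) - e *\<^sub>R d \<in> open_cone J"
          using open_cone_diff_span fin J unfolding G0_def by blast
        then show False
          using J y G(4) unfolding G0_def P_def by blast
      qed
      then show ?thesis
        using J G(2) by (auto simp: G0_def independent_insert)
    qed (auto simp: G0_def G)
    moreover have "G' \<subseteq> Pow (insert d D)"
      using G(1) by (auto simp: G'_def G0_def)
    ultimately show ?case
      by (intro exI[of _ G']) simp
  qed
  with that show thesis by blast
qed

section \<open>Quasi-polynomials\<close>

definition int_points :: "(real ^ 'n) set" where
  "int_points = {x. \<forall>k. x $ k \<in> \<int>}"

lemma int_points_add: "x \<in> int_points \<Longrightarrow> y \<in> int_points \<Longrightarrow> x + y \<in> int_points"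
  and int_points_diff: "x \<in> int_points \<Longrightarrow> y \<in> int_points \<Longrightarrow> x - y \<in> int_points"
  and int_points_scaleR: "c \<in> \<int> \<Longrightarrow> x \<in> int_points \<Longrightarrow> c *\<^sub>R x \<in> int_points"
  by (auto simp: int_points_def)

lemma int_points_sum: "(\<And>i. i \<in> I \<Longrightarrow> f i \<in> int_points) \<Longrightarrow> sum f I \<in> int_points"
  by (auto simp: int_points_def intro!: Ints_sum)

lemma int_points_inner: "x \<in> int_points \<Longrightarrow> y \<in> int_points \<Longrightarrow> x \<bullet> y \<in> \<int>"
  by (auto simp: int_points_def inner_vec_def intro!: Ints_sum)

lemma finite_bounded_int_points:
  fixes S :: "(real ^ 'n::finite) set"
  assumes "bounded S"
  shows "finite (int_points \<inter> S)"
proof -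
  obtain B where B: "\<And>x. x \<in> S \<Longrightarrow> norm x \<le> B"
    using assms by (auto simp: bounded_iff)
  have "int_points \<inter> S \<subseteq> (\<lambda>f. \<chi> k. real_of_int (f k)) ` (UNIV \<rightarrow>\<^sub>E {- \<lceil>B\<rceil>..\<lceil>B\<rceil>})"
  proof
    fix x assume x: "x \<in> int_points \<inter> S"
    have k: "real_of_int \<lfloor>x $ k\<rfloor> = x $ k" "\<lfloor>x $ k\<rfloor> \<in> {- \<lceil>B\<rceil>..\<lceil>B\<rceil>}" for k
    proof -
      show k: "real_of_int \<lfloor>x $ k\<rfloor> = x $ k"
        using x by (auto simp: int_points_def)
      have "\<bar>x $ k\<bar> \<le> B"
        using x B component_le_norm_cart[of x k] by force
      then show "\<lfloor>x $ k\<rfloor> \<in> {- \<lceil>B\<rceil>..\<lceil>B\<rceil>}"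
        using k by (simp add: abs_le_iff) linarith
    qed
    then show "x \<in> (\<lambda>f. \<chi> k. real_of_int (f k)) ` (UNIV \<rightarrow>\<^sub>E {- \<lceil>B\<rceil>..\<lceil>B\<rceil>})"
      by (intro image_eqI[of _ _ "\<lambda>k. \<lfloor>x $ k\<rfloor>"]) (simp_all add: vec_eq_iff k PiE_UNIV_domain)
  qed
  then show ?thesis
    by (rule finite_subset) (intro finite_imageI finite_PiE; simp)
qed

text \<open>Stars and bars. Listing \<open>I\<close> without repetition turns the functions into
  lists of fixed length and sum; the value 0 off \<open>I\<close> makes a function recoverable from
  its list.\<close>

lemma card_weak_compositions:
  assumes "finite I" "I \<noteq> {}"
  shows "card {m :: 'a \<Rightarrow> nat. (\<forall>i. i \<notin> I \<longrightarrow> m i = 0) \<and> sum m I = k} = (k + (card I - 1)) choose (card I - 1)"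
proof -
  obtain xs where xs: "set xs = I" "distinct xs"
    using finite_distinct_list[OF assms(1)] by auto
  then have len: "length xs = card I"
    using distinct_card by force
  have "0 < card I"
    using assms by (simp add: card_gt_0_iff)
  have "bij_betw (\<lambda>m. map m xs) {m :: 'a \<Rightarrow> nat. (\<forall>i. i \<notin> I \<longrightarrow> m i = 0) \<and> sum m I = k}
    {l. size l = card I \<and> sum_list l = k}"
  proof (rule bij_betwI')
    fix m m' :: "'a \<Rightarrow> nat"
    assume m: "m \<in> {m. (\<forall>i. i \<notin> I \<longrightarrow> m i = 0) \<and> sum m I = k}"
      and m': "m' \<in> {m. (\<forall>i. i \<notin> I \<longrightarrow> m i = 0) \<and> sum m I = k}"
    have "m i = m' i" if "map m xs = map m' xs" for i
      using m m' that xs(1) by (cases "i \<in> I") auto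
    then show "(map m xs = map m' xs) = (m = m')"
      by (auto intro!: ext)
  next
    fix m :: "'a \<Rightarrow> nat"
    assume "m \<in> {m. (\<forall>i. i \<notin> I \<longrightarrow> m i = 0) \<and> sum m I = k}"
    then show "map m xs \<in> {l. size l = card I \<and> sum_list l = k}"
      using xs len by (auto simp: sum_list_distinct_conv_sum_set)
  next
    fix l :: "nat list"
    assume l: "l \<in> {l. size l = card I \<and> sum_list l = k}"
    define m where "m i = (if i \<in> I then the (map_of (zip xs l) i) else 0)" for i
    have "map m xs = l"
      using xs l len by (intro nth_equalityI) (auto simp: m_def map_of_zip_nth)
    moreover have "sum m I = k"
      using xs l calculation sum_list_distinct_conv_sum_set[of xs m] by auto
    ultimately show "\<exists>m\<in>{m. (\<forall>i. i \<notin> I \<longrightarrow> m i = 0) \<and> sum m I = k}. l = map m xs"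
      by (intro bexI[of _ m]) (auto simp: m_def)
  qed
  then have "card {m :: 'a \<Rightarrow> nat. (\<forall>i. i \<notin> I \<longrightarrow> m i = 0) \<and> sum m I = k} = (k + card I - 1) choose k"
    unfolding card_length_sum_list[symmetric] by (rule bij_betw_same_card)
  also have "\<dots> = (k + (card I - 1)) choose (card I - 1)"
    using binomial_symmetric[of k "k + (card I - 1)"] \<open>0 < card I\<close>
    by (simp del: binomial_symmetric)
  finally show ?thesis .
qed

text \<open>The cardinality is a positive binomial coefficient, whereas \<open>card\<close> of an
  infinite set is 0.\<close>

lemma finite_weak_compositions:
  assumes "finite I" "I \<noteq> {}"
  shows "finite {m :: 'a \<Rightarrow> nat. (\<forall>i. i \<notin> I \<longrightarrow> m i = 0) \<and> sum m I = k}"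
  by (rule card_ge_0_finite) (simp add: card_weak_compositions[OF assms])

text \<open>Only a bound on the degree: the top coefficient may vanish, which keeps the notion
  closed under sums over pieces.\<close>

definition quasi_poly :: "nat \<Rightarrow> nat \<Rightarrow> (nat \<Rightarrow> real) \<Rightarrow> bool" where
  "quasi_poly N e f \<longleftrightarrow>
     (\<exists>c. (\<forall>k n. c k (n + N) = c k n) \<and> (\<forall>n. f n = (\<Sum>k\<le>e. c k n * real n ^ k)))"

lemma quasi_poly_0: "quasi_poly N e (\<lambda>_. 0)"
  unfolding quasi_poly_def by (intro exI[of _ "\<lambda>_ _. 0"]) simp

lemma quasi_poly_sum:
  assumes "\<And>w. w \<in> W \<Longrightarrow> quasi_poly N e (f w)"
  shows "quasi_poly N e (\<lambda>n. \<Sum>w\<in>W. f w n)"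
proof -
  obtain c where c: "\<And>w k n. w \<in> W \<Longrightarrow> c w k (n + N) = c w k n"
    "\<And>w n. w \<in> W \<Longrightarrow> f w n = (\<Sum>k\<le>e. c w k n * real n ^ k)"
    using assms unfolding quasi_poly_def by metis
  have "(\<Sum>w\<in>W. f w n) = (\<Sum>k\<le>e. (\<Sum>w\<in>W. c w k n) * real n ^ k)" for n
    by (simp add: c sum_distrib_right) (rule sum.swap)
  then show ?thesis
    unfolding quasi_poly_def using c by (intro exI[of _ "\<lambda>k n. \<Sum>w\<in>W. c w k n"]) simp
qed

text \<open>
  The polynomial \<open>k \<mapsto> (k + e) choose e\<close> vanishes at \<open>-1, \<dots>, -e\<close>; therefore the formula below is
  valid for all \<open>n \<ge> 0\<close> as soon as \<open>b < N (e + 1)\<close>, and not only for \<open>n \<ge> b\<close>.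
\<close>

lemma quasi_poly_binomial:
  fixes b :: int
  assumes "N > 0" "b < int N * int (Suc e)" "e \<le> d"
    and eq: "\<And>n k. int n = b + int N * int k \<Longrightarrow> f n = real ((k + e) choose e)"
    and zero: "\<And>n. (\<And>k. int n \<noteq> b + int N * int k) \<Longrightarrow> f n = 0"
  shows "quasi_poly N d f"
proof -
  \<comment> \<open>With \<open>k = (n - b) / N\<close> the factors are
    \<open>k + 1, ..., k + e\<close>, so \<open>Q\<close> is \<open>(k + e) choose e\<close> as a
    polynomial in \<open>n\<close>.\<close>
  define Q where "Q = smult (1 / fact e) (\<Prod>i\<in>{0..<e}. [:1 + real i - real_of_int b / real N, 1 / real N:])"
  have Q: "poly Q x = pochhammer ((x - of_int b) / N + 1) e / fact e" for x
    by (simp add: Q_def poly_prod pochhammer_prod diff_divide_distrib algebra_simps)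
  have "degree (\<Prod>i\<in>{0..<e}. [:1 + real i - real_of_int b / real N, 1 / real N:]) \<le>
      sum (degree \<circ> (\<lambda>i. [:1 + real i - real_of_int b / real N, 1 / real N:])) {0..<e}"
    by (rule degree_prod_sum_le) simp
  also have "\<dots> \<le> (\<Sum>i\<in>{0..<e}. 1)"
    by (intro sum_mono) simp
  finally have "degree Q \<le> d"
    using assms(3) by (simp add: Q_def)
  then have Qsum: "poly Q x = (\<Sum>k\<le>d. coeff Q k * x ^ k)" for x
    unfolding poly_altdef by (intro sum.mono_neutral_left) (auto simp: coeff_eq_0)
  define c where "c k n = (if int N dvd int n - b then coeff Q k else 0)" for k n
  have "f n = (\<Sum>k\<le>d. c k n * real n ^ k)" for n
  proof (cases "int N dvd int n - b")
    case True
    then obtain k where k: "int n - b = int N * k" by auto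
    have kr: "(real n - of_int b) / N = of_int k"
    proof -
      have "real_of_int (int n - b) = real_of_int (int N * k)" using k by simp
      then show ?thesis using assms(1) by (simp add: field_simps)
    qed
    have "f n = poly Q n"
    proof (cases "k \<ge> 0")
      case True
      then have "f n = real ((nat k + e) choose e)"
        using k by (intro eq) auto
      also have "\<dots> = poly Q n"
        using True by (simp add: Q kr binomial_gbinomial gbinomial_pochhammer' add_ac)
      finally show ?thesis .
    next
      case False
      \<comment> \<open>Since \<open>n \<ge> 0\<close>, the bound on \<open>b\<close> leaves only
        \<open>-e \<le> k \<le> -1\<close>, and there one factor of \<open>Q\<close> is
        zero.\<close>
      have "int N * (- k) < int N * int (Suc e)"
        using k assms(2) by (simp add: algebra_simps)
      then have "- k < int (Suc e)"
        using assms(1) by (simp only: mult_less_cancel_left_pos of_nat_0_less_iff)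
      then have "nat (- k - 1) < e" "real_of_int k + 1 = - real (nat (- k - 1))"
        using False by auto
      then have "poly Q n = 0"
        unfolding Q kr using pochhammer_eq_0_iff by fastforce
      moreover have "f n = 0"
      proof (rule zero, rule notI)
        fix j assume "int n = b + int N * int j"
        then have "k = int j" using k assms(1) by simp
        then show False using False by simp
      qed
      ultimately show ?thesis by simp
    qed
    then show ?thesis using True by (simp add: c_def Qsum)
  next
    case False
    then have "f n = 0" by (intro zero) auto
    then show ?thesis using False by (simp add: c_def)
  qed
  moreover have "int N dvd int (n + N) - b \<longleftrightarrow> int N dvd int n - b" for n
  proof -
    have "int (n + N) - b = (int n - b) + int N" by simp
    then show ?thesis by (metis dvd_add_triv_right_iff)
  qed
  then have "c k (n + N) = c k n" for k n
    by (simp add: c_def)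
  ultimately show ?thesis
    unfolding quasi_poly_def by blast
qed

text \<open>On one residue class modulo \<open>N\<close> the coefficients are constants, so
  \<open>f\<close> is a polynomial there and division by the top power isolates
  \<open>c e n\<close>. Signs and lower bounds of \<open>f\<close> thereby pass to the leading
  coefficient.\<close>

lemma quasi_poly_coeff_limit:
  assumes "N > 0" "\<And>k n. c k (n + N) = c k n" "\<And>n. f n = (\<Sum>k\<le>e. c k n * real n ^ k)"
  shows "(\<lambda>m. f (n + m * N) / real (n + m * N) ^ e) \<longlonglongrightarrow> c e n"
proof -
  have per: "c k (n + m * N) = c k n" for k m
  proof (induction m)
    case (Suc m)
    have "n + Suc m * N = (n + m * N) + N" by simp
    then show ?case using Suc assms(2) by metis
  qed simp
  have lim: "filterlim (\<lambda>m. real (n + m * N)) at_top sequentially"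
  proof (rule filterlim_at_top_mono[OF filterlim_real_sequentially])
    show "\<forall>\<^sub>F m in sequentially. real m \<le> real (n + m * N)"
      using assms(1) by (intro always_eventually allI of_nat_mono) (simp add: trans_le_add2)
  qed
  have "(\<lambda>m. c k n * (real (n + m * N) ^ k / real (n + m * N) ^ e)) \<longlonglongrightarrow> (if k = e then c k n else 0)"
    if "k \<le> e" for k
  proof (cases "k = e")
    case True
    have "\<forall>\<^sub>F m in sequentially. real (n + m * N) > 0"
      using lim by (simp add: filterlim_at_top_dense)
    then have "\<forall>\<^sub>F m in sequentially. c k n * (real (n + m * N) ^ k / real (n + m * N) ^ e) = c k n"
      by eventually_elim (simp add: True)
    then show ?thesis using True by (simp add: tendsto_eventually)
  next
    case False
    have "(\<lambda>m. c k n * inverse (real (n + m * N) ^ (e - k))) \<longlonglongrightarrow> c k n * 0"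
      using False that
      by (intro tendsto_intros tendsto_inverse_0_at_top filterlim_pow_at_top lim) auto
    moreover have "\<forall>\<^sub>F m in sequentially. real (n + m * N) > 0"
      using lim by (simp add: filterlim_at_top_dense)
    then have "\<forall>\<^sub>F m in sequentially. c k n * inverse (real (n + m * N) ^ (e - k)) =
        c k n * (real (n + m * N) ^ k / real (n + m * N) ^ e)"
      by eventually_elim (use that in \<open>simp add: power_diff field_simps\<close>)
    ultimately show ?thesis
      using False by (simp add: tendsto_cong)
  qed
  then have "(\<lambda>m. \<Sum>k\<le>e. c k n * (real (n + m * N) ^ k / real (n + m * N) ^ e)) \<longlonglongrightarrow>
      (\<Sum>k\<le>e. if k = e then c k n else 0)"
    by (intro tendsto_sum) auto
  then show ?thesis
    by (simp add: assms(3) per sum_divide_distrib)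
qed

section \<open>Lattice points in slices of cones\<close>

lemma independent_sum_eqD:
  fixes I :: "'a::real_vector set"
  assumes "independent I" "finite I" "(\<Sum>i\<in>I. l i *\<^sub>R i) = (\<Sum>i\<in>I. m i *\<^sub>R i)" "i \<in> I"
  shows "l i = m i"
proof -
  have "(\<Sum>i\<in>I. (l i - m i) *\<^sub>R i) = 0"
    using assms(3) by (simp add: scaleR_diff_left sum_subtractf)
  then show ?thesis
    using independentD[OF assms(1,2) subset_refl _ assms(4)] by fastforce
qed

text \<open>The apex \<open>q\<close> may be non-integral; each lattice point is sorted by its
  integral representative \<open>w\<close> in the box shifted by \<open>q\<close>.
  \<open>a \<bullet> q < 0\<close> serves twice: it excludes the apex itself when \<open>I\<close>
  is empty, and it makes the bound on the weight of \<open>w\<close> strict.\<close>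

lemma quasi_poly_open_cone:
  fixes I :: "(real ^ 'n::finite) set"
  assumes I: "independent I" "I \<subseteq> int_points" "card I \<le> Suc d"
    and N: "N > 0" "\<And>i. i \<in> I \<Longrightarrow> a \<bullet> i = real N"
    and a: "a \<in> int_points" "a \<bullet> q < 0"
  shows "quasi_poly N d (\<lambda>n. real (card {x \<in> int_points. x - q \<in> open_cone I \<and> a \<bullet> x = real n}))"
proof (cases "I = {}")
  case True
  then have "{x \<in> int_points. x - q \<in> open_cone I \<and> a \<bullet> x = real n} = {}" for n
    using a(2) by (auto simp: open_cone_def)
  then show ?thesis
    by (simp only: card.empty of_nat_0 quasi_poly_0)
next
  case False
  have finI: "finite I"
    using I(1) independent_imp_finite by blast
  define e where "e = card I - 1"
  have e: "card I = Suc e" "e \<le> d"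
    using False finI I(3) by (auto simp: e_def card_gt_0_iff Suc_le_eq)
  define box where "box = {\<Sum>i\<in>I. l i *\<^sub>R i | l. \<forall>i\<in>I. 0 < l i \<and> l i \<le> 1}"
  define W where "W = {w \<in> int_points. w - q \<in> box}"
  have "finite W"
  proof -
    have "norm w \<le> norm q + (\<Sum>i\<in>I. norm i)" if w: "w - q \<in> box" for w
    proof -
      obtain l where l: "w - q = (\<Sum>i\<in>I. l i *\<^sub>R i)" "\<forall>i\<in>I. 0 < l i \<and> l i \<le> 1"
        using w by (auto simp: box_def)
      have "norm (w - q) \<le> (\<Sum>i\<in>I. norm i)"
        unfolding l(1) using l(2) by (intro sum_norm_le) (simp add: mult_left_le_one_le less_imp_le)
      then show ?thesis
        using norm_triangle_sub[of w q] by linarith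
    qed
    then have "bounded {w. w - q \<in> box}"
      by (auto simp: bounded_iff)
    moreover have "W = int_points \<inter> {w. w - q \<in> box}"
      by (auto simp: W_def)
    ultimately show ?thesis
      using finite_bounded_int_points by simp
  qed
  \<comment> \<open>Stating the weight equation over the reals avoids dividing
    \<open>n - b w\<close> by \<open>N\<close>: off the right residue class, and below
    \<open>b w\<close>, the set is simply empty.\<close>
  define M where "M w n = {m :: real ^ 'n \<Rightarrow> nat. (\<forall>i. i \<notin> I \<longrightarrow> m i = 0) \<and>
    a \<bullet> w + real N * real (sum m I) = real n}" for w n
  define b where "b w = \<lfloor>a \<bullet> w\<rfloor>" for w
  have b: "real_of_int (b w) = a \<bullet> w" if "w \<in> W" for w
    using int_points_inner[OF a(1)] that by (simp add: b_def W_def)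
  have M: "M w n = {m. (\<forall>i. i \<notin> I \<longrightarrow> m i = 0) \<and> sum m I = k}"
    if "w \<in> W" "int n = b w + int N * int k" for w n k
  proof -
    have "a \<bullet> w + real N * real j = real n \<longleftrightarrow> j = k" for j
    proof -
      have "real n = a \<bullet> w + real N * real k"
        using arg_cong[OF that(2), of real_of_int] b[OF that(1)] by simp
      then show ?thesis using N(1) by simp
    qed
    then show ?thesis
      unfolding M_def by (simp del: of_nat_sum)
  qed
  have M_empty: "M w n = {}" if "w \<in> W" "\<And>k. int n \<noteq> b w + int N * int k" for w n
  proof -
    have "a \<bullet> w + real N * real k \<noteq> real n" for k
    proof
      assume "a \<bullet> w + real N * real k = real n"
      then have "real_of_int (int n) = real_of_int (b w + int N * int k)"
        using b[OF that(1)] by simp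
      then show False
        using that(2) of_int_eq_iff by blast
    qed
    then show ?thesis
      unfolding M_def by (auto simp del: of_nat_sum)
  qed
  have finM: "finite (M w n)" if w: "w \<in> W" for w n
  proof (cases "\<exists>k. int n = b w + int N * int k")
    case True
    then obtain k where k: "int n = b w + int N * int k" ..
    show ?thesis
      unfolding M[OF w k] by (rule finite_weak_compositions[OF finI \<open>I \<noteq> {}\<close>])
  next
    case False
    then have "M w n = {}"
      by (intro M_empty[OF w]) blast
    then show ?thesis
      by simp
  qed
  have "quasi_poly N d (\<lambda>n. real (card (M w n)))" if w: "w \<in> W" for w
  proof (rule quasi_poly_binomial)
    obtain l where l: "w - q = (\<Sum>i\<in>I. l i *\<^sub>R i)" "\<forall>i\<in>I. 0 < l i \<and> l i \<le> 1"
      using w by (auto simp: W_def box_def)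
    have "a \<bullet> w - a \<bullet> q = (\<Sum>i\<in>I. l i * N)"
      using arg_cong[OF l(1), of "inner a"] N(2) by (simp add: inner_simps inner_sum_right)
    also have "\<dots> \<le> (\<Sum>i\<in>I. 1 * real N)"
      using l(2) by (intro sum_mono mult_right_mono) auto
    finally have "a \<bullet> w < real N * real (Suc e)"
      using a(2) by (simp add: e(1) algebra_simps)
    then have "real_of_int (b w) < real_of_int (int N * int (Suc e))"
      using b[OF w] by simp
    then show "b w < int N * int (Suc e)"
      using of_int_less_iff by blast
  next
    show "real (card (M w n)) = real ((k + e) choose e)" if "int n = b w + int N * int k" for n k
      unfolding M[OF w that] using card_weak_compositions[OF finI False] e by simp
  next
    show "real (card (M w n)) = 0" if "\<And>k. int n \<noteq> b w + int N * int k" for n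
      unfolding M_empty[OF w that] by simp
  qed (use N e in auto)
  then have "quasi_poly N d (\<lambda>n. \<Sum>w\<in>W. real (card (M w n)))"
    by (rule quasi_poly_sum)
  moreover have "card {x \<in> int_points. x - q \<in> open_cone I \<and> a \<bullet> x = real n} = (\<Sum>w\<in>W. card (M w n))" for n
  proof -
    have "bij_betw (\<lambda>(w, m). w + (\<Sum>i\<in>I. real (m i) *\<^sub>R i)) (Sigma W (\<lambda>w. M w n))
      {x \<in> int_points. x - q \<in> open_cone I \<and> a \<bullet> x = real n}" (is "bij_betw ?f ?S ?X")
    proof (rule bij_betwI')
      fix s t assume s: "s \<in> ?S" and t: "t \<in> ?S"
      obtain w m l where s': "s = (w, m)" "m \<in> M w n" "w - q = (\<Sum>i\<in>I. l i *\<^sub>R i)" "\<forall>i\<in>I. 0 < l i \<and> l i \<le> 1"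
        using s by (auto simp: W_def box_def)
      obtain w' m' l' where t': "t = (w', m')" "m' \<in> M w' n" "w' - q = (\<Sum>i\<in>I. l' i *\<^sub>R i)" "\<forall>i\<in>I. 0 < l' i \<and> l' i \<le> 1"
        using t by (auto simp: W_def box_def)
      have "s = t" if eq: "?f s = ?f t"
      proof -
        have "(w - q) + (\<Sum>i\<in>I. real (m i) *\<^sub>R i) = (w' - q) + (\<Sum>i\<in>I. real (m' i) *\<^sub>R i)"
          using eq s' t' by (simp add: algebra_simps)
        then have "(\<Sum>i\<in>I. (l i + real (m i)) *\<^sub>R i) = (\<Sum>i\<in>I. (l' i + real (m' i)) *\<^sub>R i)"
          unfolding s'(3) t'(3) by (simp add: scaleR_add_left sum.distrib)
        then have lm: "l i + real (m i) = l' i + real (m' i)" if "i \<in> I" for i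
          using independent_sum_eqD[OF I(1) finI _ that, of "\<lambda>i. l i + real (m i)" "\<lambda>i. l' i + real (m' i)"]
          by simp
        have "m i = m' i" for i
        proof (cases "i \<in> I")
          case True
          then have "0 < l i" "l i \<le> 1" "0 < l' i" "l' i \<le> 1"
            using s' t' by auto
          then show ?thesis
            using lm[OF True] by linarith
        next
          case False
          then show ?thesis using s' t' by (auto simp: M_def)
        qed
        then have "m = m'" by auto
        then show ?thesis
          using eq s' t' by simp
      qed
      then show "(?f s = ?f t) = (s = t)" by auto
    next
      fix s assume s: "s \<in> ?S"
      obtain w m l where s': "s = (w, m)" "w \<in> W" "m \<in> M w n" "w - q = (\<Sum>i\<in>I. l i *\<^sub>R i)" "\<forall>i\<in>I. 0 < l i \<and> l i \<le> 1"
        using s by (auto simp: W_def box_def)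
      have "?f s \<in> int_points"
        using s' I(2) by (auto simp: W_def intro!: int_points_add int_points_sum int_points_scaleR)
      moreover have "?f s - q = (\<Sum>i\<in>I. (l i + real (m i)) *\<^sub>R i)"
        using s'(4) by (simp add: s'(1) scaleR_add_left sum.distrib algebra_simps)
      then have "?f s - q \<in> open_cone I"
        unfolding open_cone_def using s'(5) by (auto intro!: exI[of _ "\<lambda>i. l i + real (m i)"] add_pos_nonneg)
      moreover have "a \<bullet> ?f s = a \<bullet> w + real N * real (sum m I)"
        by (simp add: s'(1) inner_simps inner_sum_right N(2) sum_distrib_left mult.commute)
      ultimately show "?f s \<in> ?X"
        using s'(3) by (simp add: M_def)
    next
      fix x assume x: "x \<in> ?X"
      then obtain l where l: "x - q = (\<Sum>i\<in>I. l i *\<^sub>R i)" "\<forall>i\<in>I. 0 < l i"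
        by (auto simp: open_cone_def)
      \<comment> \<open>\<open>\<lceil>l i\<rceil> - 1\<close> instead of the floor: an integral
        coefficient must leave the remainder 1, not 0.\<close>
      define m where "m i = (if i \<in> I then nat (\<lceil>l i\<rceil> - 1) else 0)" for i
      define w where "w = x - (\<Sum>i\<in>I. real (m i) *\<^sub>R i)"
      have m: "0 < l i - real (m i) \<and> l i - real (m i) \<le> 1" if "i \<in> I" for i
      proof -
        have "0 < l i" using l that by auto
        then have "0 \<le> \<lceil>l i\<rceil> - 1" by linarith
        then have "real (m i) = of_int \<lceil>l i\<rceil> - 1"
          using that by (simp add: m_def)
        then show ?thesis by linarith
      qed
      have "w - q = (\<Sum>i\<in>I. (l i - real (m i)) *\<^sub>R i)"
        unfolding w_def using l(1) by (simp add: scaleR_diff_left sum_subtractf algebra_simps)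
      then have "w - q \<in> box"
        unfolding box_def using m by (auto intro!: exI[of _ "\<lambda>i. l i - real (m i)"])
      moreover have "w \<in> int_points"
        unfolding w_def using x I(2) by (auto intro!: int_points_diff int_points_sum int_points_scaleR)
      moreover have "a \<bullet> w + real N * real (sum m I) = a \<bullet> x"
        by (simp add: w_def inner_simps inner_sum_right N(2) sum_distrib_left mult.commute)
      ultimately have "(w, m) \<in> ?S"
        using x by (auto simp: W_def M_def m_def)
      moreover have "x = ?f (w, m)"
        by (simp add: w_def)
      ultimately show "\<exists>s\<in>?S. x = ?f s" by blast
    qed
    then have "card ?X = card ?S"
      by (rule bij_betw_same_card[symmetric])
    also have "\<dots> = (\<Sum>w\<in>W. card (M w n))"
      using \<open>finite W\<close> finM by (intro card_SigmaI) auto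
    finally show ?thesis .
  qed
  ultimately show ?thesis by simp
qed

text \<open>On the finitely many generators the norm is at most a constant times \<open>a\<close>.
  The vectors with this bound form a convex cone, so it holds on the whole hull and the slices are
  bounded.\<close>

lemma finite_int_points_slice_convex_cone_hull:
  fixes D :: "(real ^ 'n::finite) set"
  assumes "finite D" "\<And>i. i \<in> D \<Longrightarrow> 0 < a \<bullet> i"
  shows "finite {x \<in> int_points. x - q \<in> convex_cone hull D \<and> a \<bullet> x = r}"
proof -
  define c where "c = (if D = {} then 1 else Max ((\<lambda>i. norm i / (a \<bullet> i)) ` D))"
  have "norm y \<le> c * (a \<bullet> y)" if "y \<in> convex_cone hull D" for y
  proof -
    have "convex_cone hull D \<subseteq> {y. norm y \<le> c * (a \<bullet> y)}"
    proof (rule hull_minimal)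
      show "D \<subseteq> {y. norm y \<le> c * (a \<bullet> y)}"
      proof
        fix i assume i: "i \<in> D"
        then have "norm i / (a \<bullet> i) \<le> c"
          using assms(1) by (auto simp: c_def)
        then show "i \<in> {y. norm y \<le> c * (a \<bullet> y)}"
          using assms(2)[OF i] by (simp add: field_simps)
      qed
      show "convex_cone {y. norm y \<le> c * (a \<bullet> y)}"
        unfolding convex_cone_iff
      proof (intro conjI ballI allI impI)
        fix x y assume "x \<in> {y. norm y \<le> c * (a \<bullet> y)}" "y \<in> {y. norm y \<le> c * (a \<bullet> y)}"
        then show "x + y \<in> {y. norm y \<le> c * (a \<bullet> y)}"
          using norm_triangle_ineq[of x y] by (simp add: inner_simps distrib_left)
      next
        fix x and t :: real assume "x \<in> {y. norm y \<le> c * (a \<bullet> y)}" "0 \<le> t"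
        then show "t *\<^sub>R x \<in> {y. norm y \<le> c * (a \<bullet> y)}"
          using mult_left_mono[of "norm x" "c * (a \<bullet> x)" t] by (simp add: mult_ac)
      qed simp
    qed
    then show ?thesis using that by auto
  qed
  then have "norm x \<le> norm q + c * (r - a \<bullet> q)" if "x - q \<in> convex_cone hull D" "a \<bullet> x = r" for x
    using that norm_triangle_sub[of x q] by (force simp: inner_simps)
  then have "bounded {x. x - q \<in> convex_cone hull D \<and> a \<bullet> x = r}"
    by (auto simp: bounded_iff)
  moreover have "{x \<in> int_points. x - q \<in> convex_cone hull D \<and> a \<bullet> x = r} =
      int_points \<inter> {x. x - q \<in> convex_cone hull D \<and> a \<bullet> x = r}"
    by auto
  ultimately show ?thesis
    using finite_bounded_int_points by simp
qed

text \<open>Independent sets of generators have at most \<open>dim D\<close> elements, which bounds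
  the degree on each piece; the slices of the pieces are disjoint and finite, so their cardinalities
  add up.\<close>

lemma quasi_poly_convex_cone_hull:
  fixes D :: "(real ^ 'n::finite) set"
  assumes D: "finite D" "D \<subseteq> int_points" "dim D \<le> Suc d"
    and N: "N > 0" "\<And>i. i \<in> D \<Longrightarrow> a \<bullet> i = real N"
    and a: "a \<in> int_points" "a \<bullet> q < 0"
  shows "quasi_poly N d (\<lambda>n. real (card {x \<in> int_points. x - q \<in> convex_cone hull D \<and> a \<bullet> x = real n}))"
proof -
  obtain G where G: "G \<subseteq> Pow D" "\<And>I. I \<in> G \<Longrightarrow> independent I"
    "disjoint_family_on open_cone G" "convex_cone hull D = (\<Union>I\<in>G. open_cone I)"
    using simplicial_decomposition_of_cone[of D a] D(1) N by auto
  define X where "X n I = {x \<in> int_points. x - q \<in> open_cone I \<and> a \<bullet> x = real n}" for n I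
  have "quasi_poly N d (\<lambda>n. \<Sum>I\<in>G. real (card (X n I)))"
    unfolding X_def
  proof (intro quasi_poly_sum quasi_poly_open_cone)
    fix I assume I: "I \<in> G"
    then have "I \<subseteq> D" using G(1) by auto
    then show "I \<subseteq> int_points" "\<And>i. i \<in> I \<Longrightarrow> a \<bullet> i = real N"
      using D(2) N(2) by auto
    have "card I \<le> dim D"
      using \<open>I \<subseteq> D\<close> G(2)[OF I] by (rule independent_card_le_dim)
    then show "card I \<le> Suc d" using D(3) by simp
  qed (use G(2) N(1) a in auto)
  moreover have "card {x \<in> int_points. x - q \<in> convex_cone hull D \<and> a \<bullet> x = real n} = (\<Sum>I\<in>G. card (X n I))" for n
  proof -
    have eq: "{x \<in> int_points. x - q \<in> convex_cone hull D \<and> a \<bullet> x = real n} = (\<Union>I\<in>G. X n I)"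
      by (auto simp: X_def G(4))
    have "finite (\<Union>I\<in>G. X n I)"
      unfolding eq[symmetric] using D N by (intro finite_int_points_slice_convex_cone_hull) auto
    then have "\<forall>I\<in>G. finite (X n I)"
      by (meson UN_upper finite_subset)
    moreover have "finite G"
      using G(1) D(1) by (meson finite_Pow_iff finite_subset)
    moreover have "\<forall>I\<in>G. \<forall>J\<in>G. I \<noteq> J \<longrightarrow> X n I \<inter> X n J = {}"
      using G(3) unfolding X_def disjoint_family_on_def by blast
    ultimately show ?thesis
      unfolding eq by (intro card_UN_disjoint)
  qed
  ultimately show ?thesis by simp
qed

text \<open>To \<open>u\<close> one adds natural combinations of a basis \<open>I\<close> chosen in
  \<open>D\<close>: \<open>m\<close> summands raise the weight by \<open>m N\<close>, and
  independence keeps the results distinct. The bound is the number of weak compositions of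
  \<open>m\<close> into \<open>d + 1\<close> parts.\<close>

lemma slice_count_convex_cone_hull_ge:
  fixes D :: "(real ^ 'n::finite) set"
  assumes D: "finite D" "D \<subseteq> int_points" "dim D = Suc d"
    and N: "N > 0" "\<And>i. i \<in> D \<Longrightarrow> a \<bullet> i = real N"
    and u: "u \<in> int_points" "u - q \<in> convex_cone hull D" "a \<bullet> u = real n"
  shows "(m + d) choose d \<le> card {x \<in> int_points. x - q \<in> convex_cone hull D \<and> a \<bullet> x = real (n + m * N)}"
    (is "_ \<le> card ?X")
proof -
  obtain I where I: "I \<subseteq> D" "independent I" "card I = Suc d"
    using basis_exists[of D] D(3) by metis
  have finI: "finite I" "I \<noteq> {}"
    using I finite_subset[OF I(1) D(1)] by auto
  let ?M = "{j :: real ^ 'n \<Rightarrow> nat. (\<forall>i. i \<notin> I \<longrightarrow> j i = 0) \<and> sum j I = m}"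
  let ?f = "\<lambda>j. u + (\<Sum>i\<in>I. real (j i) *\<^sub>R i)"
  have "inj_on ?f ?M"
  proof (rule inj_onI)
    fix j k assume jk: "j \<in> ?M" "k \<in> ?M" "?f j = ?f k"
    have "j i = k i" for i
      using jk independent_sum_eqD[OF I(2) finI(1), of "\<lambda>i. real (j i)" "\<lambda>i. real (k i)" i]
      by (cases "i \<in> I") auto
    then show "j = k" by auto
  qed
  then have "card (?f ` ?M) = card ?M"
    by (rule card_image)
  moreover have "?f ` ?M \<subseteq> ?X"
  proof
    fix x assume "x \<in> ?f ` ?M"
    then obtain j where j: "j \<in> ?M" "x = ?f j" by blast
    have "x \<in> int_points"
      unfolding j(2) using u(1) I(1) D(2) by (auto intro!: int_points_add int_points_sum int_points_scaleR)
    moreover have "(u - q) + (\<Sum>i\<in>I. real (j i) *\<^sub>R i) \<in> convex_cone hull D"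
      using u(2) I(1) by (intro convex_cone_hull_add sum_in_convex_cone_hull) auto
    then have "x - q \<in> convex_cone hull D"
      unfolding j(2) by (simp add: algebra_simps)
    moreover have "a \<bullet> x = real n + (\<Sum>i\<in>I. real (j i) * real N)"
      using I(1) N(2) u(3) unfolding j(2) by (simp add: inner_simps inner_sum_right subset_iff)
    then have "a \<bullet> x = real (n + m * N)"
      using j(1) by (simp add: flip: sum_distrib_right of_nat_sum)
    ultimately show "x \<in> ?X" by simp
  qed
  moreover have "finite ?X"
    using D N by (intro finite_int_points_slice_convex_cone_hull) auto
  then have "card (?f ` ?M) \<le> card ?X" if "?f ` ?M \<subseteq> ?X"
    using that by (rule card_mono)
  ultimately have "card ?M \<le> card ?X"
    by simp
  then show ?thesis
    using card_weak_compositions[OF finI] I(3) by simp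
qed

text \<open>
  Along \<open>n\<^sub>0 + m N\<close>, with \<open>n\<^sub>0\<close> the weight of a lattice point of the cone, the count grows at least
  like \<open>m ^ d\<close>; so the leading coefficient cannot vanish at \<open>n\<^sub>0\<close>.
\<close>

lemma quasi_polynomial_coeffs_convex_cone_hull:
  fixes D :: "(real ^ 'n::finite) set"
  assumes D: "finite D" "D \<subseteq> int_points" "dim D = Suc d"
    and N: "N > 0" "\<And>i. i \<in> D \<Longrightarrow> a \<bullet> i = real N"
    and a: "a \<in> int_points" "a \<bullet> q < 0"
    and u: "u \<in> int_points" "u - q \<in> convex_cone hull D" "a \<bullet> u = real n\<^sub>0"
  shows "\<exists>c. quasi_polynomial_coeffs
      (\<lambda>n. of_nat (card {x \<in> int_points. x - q \<in> convex_cone hull D \<and> a \<bullet> x = real n})) d N c \<and>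
    (\<forall>n. c d n \<in> \<real>\<^sub>\<ge>\<^sub>0)"
proof -
  define f where "f n = card {x \<in> int_points. x - q \<in> convex_cone hull D \<and> a \<bullet> x = real n}" for n
  have "quasi_poly N d (\<lambda>n. real (f n))"
    unfolding f_def using D N a by (intro quasi_poly_convex_cone_hull) auto
  then obtain c where c: "\<And>k n. c k (n + N) = c k n" "\<And>n. real (f n) = (\<Sum>k\<le>d. c k n * real n ^ k)"
    unfolding quasi_poly_def by blast
  note lim = quasi_poly_coeff_limit[of N c, OF N(1) c(1) c(2)]
  have nonneg: "0 \<le> c d n" for n
    by (rule tendsto_lowerbound[OF lim]) (auto intro!: always_eventually)
  \<comment> \<open>Read off from two estimates:
    \<open>n\<^sub>0 + m N \<le> m (n\<^sub>0 + N)\<close> for \<open>m \<ge> 1\<close>, and the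
    binomial coefficient is at least \<open>((m + d) / d) ^ d\<close>. The factor
    \<open>Suc d\<close> in place of \<open>d\<close> keeps the denominator non-zero for
    \<open>d = 0\<close>.\<close>
  define r where "r = (1 / (real (Suc d) * real (n\<^sub>0 + N))) ^ d"
  have "r \<le> c d n\<^sub>0"
  proof (rule tendsto_lowerbound[OF lim])
    show "\<forall>\<^sub>F m in sequentially. r \<le> real (f (n\<^sub>0 + m * N)) / real (n\<^sub>0 + m * N) ^ d"
      using eventually_ge_at_top[of 1]
    proof eventually_elim
      case (elim m)
      have pos: "0 < n\<^sub>0 + m * N"
        using N elim by simp
      have "real (n\<^sub>0 + m * N) \<le> real (m * (n\<^sub>0 + N))"
        using elim by (intro of_nat_mono) (simp add: distrib_left)
      then have "real (n\<^sub>0 + m * N) / real (n\<^sub>0 + N) \<le> real m"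
        using N(1) by (simp add: divide_le_eq)
      then have "real (n\<^sub>0 + m * N) / real (n\<^sub>0 + N) / real (Suc d) \<le> real m / real (Suc d)"
        by (intro divide_right_mono) auto
      then have "real (n\<^sub>0 + m * N) / (real (Suc d) * real (n\<^sub>0 + N)) \<le> real m / real (Suc d)"
        by (simp only: divide_divide_eq_left mult.commute)
      also have "\<dots> \<le> real (m + d) / real d" if "d > 0"
        using that by (intro frac_le) auto
      finally have le: "real (n\<^sub>0 + m * N) / (real (Suc d) * real (n\<^sub>0 + N)) \<le> real (m + d) / real d" if "d > 0"
        using that by simp
      have "r * real (n\<^sub>0 + m * N) ^ d = (real (n\<^sub>0 + m * N) / (real (Suc d) * real (n\<^sub>0 + N))) ^ d"
        unfolding r_def by (simp add: power_divide)
      also have "\<dots> \<le> (real (m + d) / real d) ^ d"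
        using le by (cases "d = 0") (auto intro!: power_mono)
      also have "\<dots> \<le> real ((m + d) choose d)"
        using binomial_ge_n_over_k_pow_k[of d "m + d", where ?'a = real] by simp
      also have "\<dots> \<le> real (f (n\<^sub>0 + m * N))"
        unfolding f_def using slice_count_convex_cone_hull_ge[OF D N u] by (intro of_nat_mono)
      finally show ?case
        using pos by (simp only: pos_le_divide_eq zero_less_power of_nat_0_less_iff)
    qed
  qed auto
  moreover have "0 < r"
    using N by (simp add: r_def)
  ultimately have "c d n\<^sub>0 \<noteq> 0" by simp
  moreover have "of_nat (f n) = (\<Sum>k\<le>d. complex_of_real (c k n) * of_nat n ^ k)" for n
    using arg_cong[OF c(2), of complex_of_real n] by simp
  ultimately have "quasi_polynomial_coeffs (\<lambda>n. of_nat (f n)) d N (\<lambda>k n. complex_of_real (c k n))"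
    unfolding quasi_polynomial_coeffs_def using N(1) c(1) by auto
  then show ?thesis
    using nonneg unfolding f_def by (intro exI[of _ "\<lambda>k n. complex_of_real (c k n)"]) simp
qed

section \<open>Edges of rational cones\<close>

text \<open>
  Rationality of an extreme ray is read off from additive maps \<open>\<psi> : \<real> \<rightarrow> \<real>\<close>: applied to every
  coordinate, such a map preserves all linear relations with rational coefficients.
\<close>

lemma rat_linear_functional:
  fixes x :: real
  assumes "x \<notin> \<rat>"
  shows "\<exists>\<psi> :: real \<Rightarrow> real. (\<forall>y z. \<psi> (y + z) = \<psi> y + \<psi> z) \<and>
    (\<forall>q y. \<psi> (of_rat q * y) = of_rat q * \<psi> y) \<and> \<psi> 1 = 0 \<and> \<psi> x = 1"
proof -
  interpret Q: vector_space "\<lambda>(q::rat) (y::real). of_rat q * y"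
    by unfold_locales (auto simp: algebra_simps of_rat_add of_rat_mult)
  interpret QQ: vector_space_pair "\<lambda>(q::rat) (y::real). of_rat q * y" "\<lambda>(q::rat) (y::real). of_rat q * y"
    by unfold_locales
  have "x \<notin> Q.span {1}"
    using assms by (auto simp: Q.span_singleton Rats_def)
  then have "Q.independent {x, 1}"
    by (simp add: Q.independent_insert)
  then obtain g where g: "Vector_Spaces.linear (\<lambda>(q::rat) (y::real). of_rat q * y) (\<lambda>(q::rat) (y::real). of_rat q * y) g"
    "\<forall>b\<in>{x, 1}. g b = (if b = x then 1 else 0)"
    using QQ.linear_independent_extend[of "{x, 1}" "\<lambda>b. if b = x then 1 else 0"] by blast
  interpret g: Vector_Spaces.linear "\<lambda>(q::rat) (y::real). of_rat q * y" "\<lambda>(q::rat) (y::real). of_rat q * y" g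
    by (rule g(1))
  have "x \<noteq> 1" using assms by auto
  then show ?thesis
    using g(2) g.add g.scale by (intro exI[of _ g]) auto
qed

lemma primitive_int_vec:
  fixes y :: "real ^ 'n::finite"
  assumes y: "y \<in> int_points" "y \<noteq> 0"
  obtains t and z :: "int ^ 'n" where "0 < t" "real_vec z = t *\<^sub>R y" "Gcd (range (\<lambda>k. z $ k)) = 1"
proof -
  define g where "g = Gcd (range (\<lambda>k. \<lfloor>y $ k\<rfloor>))"
  define z :: "int ^ 'n" where "z = (\<chi> k. \<lfloor>y $ k\<rfloor> div g)"
  have fl: "of_int \<lfloor>y $ k\<rfloor> = y $ k" for k
    using y(1) by (auto simp: int_points_def)
  have gz: "\<lfloor>y $ k\<rfloor> = g * z $ k" for k
    unfolding z_def g_def by simp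
  have "g \<noteq> 0"
  proof
    assume "g = 0"
    then have "y $ k = 0" for k
      using gz[of k] fl[of k] by simp
    then show False using y(2) by (simp add: vec_eq_iff)
  qed
  then have "0 < g"
    by (simp add: g_def order_less_le)
  have "range (\<lambda>k. \<lfloor>y $ k\<rfloor>) = (*) g ` range (\<lambda>k. z $ k)"
    by (simp add: gz image_image)
  then have "g = normalize (g * Gcd (range (\<lambda>k. z $ k)))"
    unfolding g_def[symmetric] using Gcd_mult[of g "range (\<lambda>k. z $ k)"] by (metis g_def)
  then have "g * Gcd (range (\<lambda>k. z $ k)) = g * 1"
    using \<open>0 < g\<close> by (simp add: abs_mult)
  then have "Gcd (range (\<lambda>k. z $ k)) = 1"
    using \<open>0 < g\<close> by simp
  moreover have "real_vec z = (1 / real_of_int g) *\<^sub>R y"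
  proof -
    have "real_of_int (z $ k) = y $ k / real_of_int g" for k
      using gz[of k] fl[of k] \<open>0 < g\<close> by (metis nonzero_mult_div_cancel_left of_int_eq_0_iff of_int_mult order_less_irrefl)
    then show ?thesis
      by (simp add: real_vec_def vec_eq_iff)
  qed
  ultimately show thesis
    using that[of "1 / real_of_int g" z] \<open>0 < g\<close> by simp
qed

text \<open>What the study of edges needs from the cone: finitely many non-zero normals make it a
  polyhedron, their integrality makes extreme rays rational, and non-negative coordinates make it
  pointed with compact cross-sections.\<close>

locale integral_cone =
  fixes A :: "(real ^ 'n::finite) set" and K :: "(real ^ 'n) set"
  assumes finite_A: "finite A" and int_A: "A \<subseteq> int_points" and nonzero_A: "0 \<notin> A"
    and K_eq: "K = {y. \<forall>a\<in>A. 0 \<le> a \<bullet> y}"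
    and K_nonneg: "\<And>y k. y \<in> K \<Longrightarrow> 0 \<le> y $ k"
begin

lemma convex_cone_K: "convex_cone K"
  unfolding K_eq convex_cone_iff by (auto simp: inner_simps)

lemma polyhedron_K: "polyhedron K"
  unfolding polyhedron_def
proof (intro exI[of _ "(\<lambda>a. {y. (- a) \<bullet> y \<le> 0}) ` A"] conjI)
  show "K = \<Inter> ((\<lambda>a. {y. (- a) \<bullet> y \<le> 0}) ` A)"
    by (auto simp: K_eq)
  show "\<forall>h\<in>(\<lambda>a. {y. (- a) \<bullet> y \<le> 0}) ` A. \<exists>a b. a \<noteq> 0 \<and> h = {x. a \<bullet> x \<le> b}"
  proof
    fix h assume "h \<in> (\<lambda>a. {y. (- a) \<bullet> y \<le> 0}) ` A"
    then obtain a where "a \<in> A" "h = {y. (- a) \<bullet> y \<le> 0}" by auto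
    moreover from this have "- a \<noteq> 0" using nonzero_A by auto
    ultimately show "\<exists>a b. a \<noteq> 0 \<and> h = {x. a \<bullet> x \<le> b}" by blast
  qed
qed (use finite_A in auto)

lemma interior_K: "interior K = {y. \<forall>a\<in>A. 0 < a \<bullet> y}"
proof
  show "interior K \<subseteq> {y. \<forall>a\<in>A. 0 < a \<bullet> y}"
  proof (intro subsetI CollectI ballI)
    fix y a assume y: "y \<in> interior K" and a: "a \<in> A"
    have "interior K \<subseteq> interior {y. 0 \<le> a \<bullet> y}"
      using a by (intro interior_mono) (auto simp: K_eq)
    moreover have "interior {y. 0 \<le> a \<bullet> y} = {y. 0 < a \<bullet> y}"
      using a nonzero_A by (intro interior_halfspace_ge) auto
    ultimately show "0 < a \<bullet> y" using y by auto
  qed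
  have "{y. \<forall>a\<in>A. 0 < a \<bullet> y} = (\<Inter>a\<in>A. {y. 0 < a \<bullet> y})" by auto
  then have "open {y. \<forall>a\<in>A. 0 < a \<bullet> y}"
    using finite_A by (auto intro!: open_INT open_halfspace_gt)
  then show "{y. \<forall>a\<in>A. 0 < a \<bullet> y} \<subseteq> interior K"
    by (intro interior_maximal) (auto simp: K_eq less_imp_le)
qed

text \<open>On \<open>K\<close> this functional is non-negative and vanishes only at 0; its level 1
  cuts out a compact base of the cone.\<close>

definition height :: "real ^ 'n \<Rightarrow> real" where
  "height y = (\<Sum>k\<in>UNIV. y $ k)"

lemma height_add: "height (y + z) = height y + height z"
  and height_diff: "height (y - z) = height y - height z"
  and height_scaleR: "height (c *\<^sub>R y) = c * height y"
  and height_0: "height 0 = 0"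
  by (simp_all add: height_def sum.distrib sum_subtractf sum_distrib_left)

lemma height_nonneg: "y \<in> K \<Longrightarrow> 0 \<le> height y"
  using K_nonneg unfolding height_def by (simp add: sum_nonneg)

lemma height_eq_0_iff: "y \<in> K \<Longrightarrow> height y = 0 \<longleftrightarrow> y = 0"
  using K_nonneg unfolding height_def by (simp add: sum_nonneg_eq_0_iff vec_eq_iff)

section \<open>Faces and extreme rays\<close>

lemma face_contains_0:
  assumes "F face_of K" "F \<noteq> {}"
  shows "0 \<in> F"
proof -
  obtain x where x: "x \<in> F" using assms(2) by auto
  then have "x \<in> K" using face_of_imp_subset[OF assms(1)] by auto
  show ?thesis
  proof (cases "x = 0")
    case False
    \<comment> \<open>\<open>x\<close> is the midpoint of \<open>0\<close> and \<open>2 x\<close>,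
      and a face containing an inner point of a segment in \<open>K\<close> contains its
      ends.\<close>
    have "2 *\<^sub>R x \<in> K" "0 \<in> K"
      using \<open>x \<in> K\<close> convex_cone_K by (auto simp: convex_cone_iff)
    moreover have "x \<in> open_segment 0 (2 *\<^sub>R x)"
      using False by (auto simp: in_segment intro!: exI[of _ "1/2"])
    ultimately show ?thesis
      using assms(1) x unfolding face_of_def by blast
  qed (use x in simp)
qed

lemma face_convex_cone:
  assumes F: "F face_of K" "F \<noteq> {}"
  shows "convex_cone F"
proof -
  have conv: "convex F" using F(1) by (rule face_of_imp_convex)
  have 0: "0 \<in> F" using face_contains_0[OF F] .
  have scale: "t *\<^sub>R x \<in> F" if "x \<in> F" "0 \<le> t" for x t
  proof (cases "t \<le> 1")
    case True
    then show ?thesis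
      using conv 0 that convexD[OF conv 0 \<open>x \<in> F\<close>, of "1 - t" t] by simp
  next
    case False
    have "x \<in> K" using that face_of_imp_subset[OF F(1)] by auto
    then have "t *\<^sub>R x \<in> K" "0 \<in> K"
      using that convex_cone_K by (auto simp: convex_cone_iff)
    moreover have "x \<in> open_segment 0 (t *\<^sub>R x)" if "x \<noteq> 0"
      using False that by (auto simp: in_segment intro!: exI[of _ "1/t"])
    ultimately show ?thesis
      using F(1) \<open>x \<in> F\<close> 0 unfolding face_of_def by (cases "x = 0") auto
  qed
  then show ?thesis
    using conv 0 unfolding convex_cone_def conic_def by auto
qed

text \<open>Extremality is phrased by symmetric perturbations because this is the form in which a
  perturbation built from the coordinates of \<open>w\<close> can be tested.\<close>

definition extreme_ray :: "real ^ 'n \<Rightarrow> bool" where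
  "extreme_ray w \<longleftrightarrow> w \<in> K \<and> w \<noteq> 0 \<and>
     (\<forall>z. w + z \<in> K \<longrightarrow> w - z \<in> K \<longrightarrow> (\<exists>c. z = c *\<^sub>R w))"

text \<open>For an irrational ratio, apply \<open>\<psi>\<close> to all coordinates of
  \<open>w\<close> divided by \<open>w $ j\<close>. Integral normals vanishing on \<open>w\<close>
  also vanish on the result \<open>z\<close>, so a small multiple of \<open>z\<close> is an
  admissible perturbation and hence a multiple of \<open>w\<close>; but
  \<open>z $ j = \<psi> 1 = 0\<close> and \<open>z $ k = 1\<close>.\<close>

lemma extreme_ray_rational:
  assumes "extreme_ray w" "w $ j \<noteq> 0"
  shows "w $ k / w $ j \<in> \<rat>"
proof (rule ccontr)
  assume "w $ k / w $ j \<notin> \<rat>"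
  from rat_linear_functional[OF this] obtain \<psi> :: "real \<Rightarrow> real" where
    "(\<forall>y z. \<psi> (y + z) = \<psi> y + \<psi> z) \<and> (\<forall>q y. \<psi> (of_rat q * y) = of_rat q * \<psi> y) \<and>
      \<psi> 1 = 0 \<and> \<psi> (w $ k / w $ j) = 1" ..
  then have add: "\<And>y z. \<psi> (y + z) = \<psi> y + \<psi> z"
    and scale: "\<And>q y. \<psi> (of_rat q * y) = of_rat q * \<psi> y"
    and 1: "\<psi> 1 = 0" and x: "\<psi> (w $ k / w $ j) = 1"
    by simp_all
  have 0: "\<psi> 0 = 0"
    using scale[of 0 0] by (simp only: of_rat_0 mult_zero_left)
  have sum: "\<psi> (sum f S) = (\<Sum>i\<in>S. \<psi> (f i))" for f and S :: "'n set"
    by (induction S rule: infinite_finite_induct) (simp_all add: 0 add)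
  have Ints: "\<psi> (c * y) = c * \<psi> y" if cZ: "c \<in> \<int>" for c y
  proof -
    obtain i where "c = of_int i"
      using cZ by (rule Ints_cases)
    then show ?thesis using scale[of "of_int i" y] by (simp only: of_rat_of_int_eq)
  qed
  define z where "z = (\<chi> i. \<psi> (w $ i / w $ j))"
  have wK: "w \<in> K" using assms(1) by (simp add: extreme_ray_def)
  have tight: "a \<bullet> z = 0" if "a \<in> A" "a \<bullet> w = 0" for a
  proof -
    have "a \<bullet> z = (\<Sum>i\<in>UNIV. a $ i * \<psi> (w $ i / w $ j))"
      by (simp add: inner_vec_def z_def)
    also have "\<dots> = (\<Sum>i\<in>UNIV. \<psi> (a $ i * (w $ i / w $ j)))"
      using that(1) int_A by (intro sum.cong refl Ints[symmetric]) (auto simp: int_points_def)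
    also have "\<dots> = \<psi> ((a \<bullet> w) / w $ j)"
      by (simp add: sum[symmetric] inner_vec_def sum_divide_distrib)
    finally show ?thesis using that(2) 0 by simp
  qed
  \<comment> \<open>Small enough for the normals with positive slack at \<open>w\<close>; the tight
    ones put no condition on \<open>e\<close>.\<close>
  define e where "e = Min (insert 1 ((\<lambda>a. a \<bullet> w / (1 + \<bar>a \<bullet> z\<bar>)) ` {a \<in> A. 0 < a \<bullet> w}))"
  have e: "0 < e"
    unfolding e_def using finite_A by (auto intro!: divide_pos_pos add_pos_nonneg)
  have "\<bar>e * (a \<bullet> z)\<bar> \<le> a \<bullet> w" if a: "a \<in> A" for a
  proof (cases "a \<bullet> w = 0")
    case True
    then show ?thesis using tight[OF a] by simp
  next
    case False
    then have "0 < a \<bullet> w"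
      using wK a unfolding K_eq by fastforce
    then have "e \<le> a \<bullet> w / (1 + \<bar>a \<bullet> z\<bar>)"
      unfolding e_def using finite_A a by auto
    then have "e * (1 + \<bar>a \<bullet> z\<bar>) \<le> a \<bullet> w"
      by (simp add: pos_le_divide_eq)
    then show ?thesis
      using e by (simp add: abs_mult algebra_simps)
  qed
  then have "0 \<le> a \<bullet> w + e * (a \<bullet> z)" "0 \<le> a \<bullet> w - e * (a \<bullet> z)" if "a \<in> A" for a
    using that by (fastforce simp: abs_le_iff)+
  then have "w + e *\<^sub>R z \<in> K" "w - e *\<^sub>R z \<in> K"
    by (simp_all add: K_eq inner_simps)
  then obtain c where c: "e *\<^sub>R z = c *\<^sub>R w"
    using assms(1) unfolding extreme_ray_def by blast
  have "e * z $ i = c * w $ i" for i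
    using c by (metis vector_scaleR_component real_scaleR_def)
  from this[of j] this[of k] show False
    using assms(2) e x 1 by (auto simp: z_def)
qed

lemma extreme_ray_int_multiple:
  assumes w: "extreme_ray w"
  obtains t where "0 < t" "t *\<^sub>R w \<in> int_points"
proof -
  obtain j where j: "w $ j \<noteq> 0"
    using w by (auto simp: extreme_ray_def vec_eq_iff)
  then have "0 < w $ j"
    using w K_nonneg[of w j] by (auto simp: extreme_ray_def)
  have "\<exists>q::nat. 0 < q \<and> real q * (w $ k / w $ j) \<in> \<int>" for k
  proof -
    obtain m n where mn: "n > 0" "w $ k / w $ j = of_int m / of_int n"
      using extreme_ray_rational[OF w j, of k] by (auto elim!: Rats_cases')
    then have "real (nat n) * (w $ k / w $ j) = of_int m"
      by simp
    then show ?thesis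
      using mn by (intro exI[of _ "nat n"]) auto
  qed
  then obtain q :: "'n \<Rightarrow> nat" where q: "\<And>k. 0 < q k" "\<And>k. real (q k) * (w $ k / w $ j) \<in> \<int>"
    by metis
  \<comment> \<open>The product of the denominators clears all ratios at once; dividing by
    \<open>w $ j\<close> turns the ratios back into coordinates of \<open>w\<close>.\<close>
  define t where "t = (\<Prod>k\<in>UNIV. real (q k)) / w $ j"
  have "t * w $ k \<in> \<int>" for k
  proof -
    have "(\<Prod>i\<in>UNIV. real (q i)) = real (q k) * (\<Prod>i\<in>UNIV - {k}. real (q i))"
      by (simp add: prod.remove)
    then have "t * w $ k = (\<Prod>i\<in>UNIV - {k}. real (q i)) * (real (q k) * (w $ k / w $ j))"
      by (simp add: t_def)
    also have "\<dots> \<in> \<int>"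
      using q(2) by (intro Ints_mult[OF Ints_prod]) auto
    finally show ?thesis .
  qed
  then have "t *\<^sub>R w \<in> int_points"
    by (simp add: int_points_def)
  moreover have "0 < t"
    unfolding t_def using q(1) \<open>0 < w $ j\<close> by (intro divide_pos_pos prod_pos) auto
  ultimately show thesis using that by blast
qed

text \<open>If \<open>t w\<close> lies between \<open>a\<close> and \<open>b\<close>, scale their
  contributions to \<open>a' + b' = w\<close>. Then \<open>a' - b'\<close> is an admissible
  perturbation, as adding it to \<open>w\<close> or subtracting it gives \<open>2 a'\<close> or
  \<open>2 b'\<close>. Extremality puts both ends on the line of \<open>w\<close>, and the sign of
  \<open>height\<close> puts them on the ray.\<close>

lemma extreme_ray_face:
  assumes w: "extreme_ray w"
  shows "(\<lambda>t. t *\<^sub>R w) ` {0..} face_of K"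
  unfolding face_of_def
proof (intro conjI ballI impI)
  have wK: "w \<in> K" using w by (simp add: extreme_ray_def)
  show "(\<lambda>t. t *\<^sub>R w) ` {0..} \<subseteq> K"
    using wK convex_cone_K by (auto simp: convex_cone_iff)
  show "convex ((\<lambda>t. t *\<^sub>R w) ` {0..})"
    by (intro convex_linear_image) (auto intro!: linearI simp: scaleR_add_left)
  fix a b x assume ab: "a \<in> K" "b \<in> K" and "x \<in> (\<lambda>t. t *\<^sub>R w) ` {0..}" and x: "x \<in> open_segment a b"
  then obtain t where t: "0 \<le> t" "x = t *\<^sub>R w" by auto
  obtain u where u: "0 < u" "u < 1" "x = (1 - u) *\<^sub>R a + u *\<^sub>R b" "a \<noteq> b"
    using x by (auto simp: in_segment)
  have "t \<noteq> 0"
  proof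
    assume "t = 0"
    then have "(1 - u) * height a + u * height b = 0"
      using u(3) t(2) by (metis height_0 height_add height_scaleR scaleR_zero_left)
    then have "(1 - u) * height a = 0" "u * height b = 0"
      using u height_nonneg ab by (simp_all add: add_nonneg_eq_0_iff)
    then show False
      using u ab height_eq_0_iff by auto
  qed
  then have "0 < t" using t by simp
  define a' where "a' = ((1 - u) / t) *\<^sub>R a"
  define b' where "b' = (u / t) *\<^sub>R b"
  have "a' \<in> K" "b' \<in> K"
    unfolding a'_def b'_def using ab u \<open>0 < t\<close> convex_cone_K by (auto simp: convex_cone_iff)
  have "a' + b' = (1 / t) *\<^sub>R x"
    by (simp add: a'_def b'_def u(3) scaleR_add_right)
  then have w_eq: "w = a' + b'"
    using t \<open>0 < t\<close> by simp
  have "w + (a' - b') = 2 *\<^sub>R a'" "w - (a' - b') = 2 *\<^sub>R b'"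
    by (simp_all add: w_eq scaleR_2)
  then have "w + (a' - b') \<in> K" "w - (a' - b') \<in> K"
    using \<open>a' \<in> K\<close> \<open>b' \<in> K\<close> convex_cone_K by (simp_all add: convex_cone_iff)
  then obtain c where c: "a' - b' = c *\<^sub>R w"
    using w unfolding extreme_ray_def by blast
  have "2 *\<^sub>R a' = (1 + c) *\<^sub>R w" "2 *\<^sub>R b' = (1 - c) *\<^sub>R w"
    using c w_eq by (simp_all add: scaleR_2 algebra_simps)
  then have "(1/2) *\<^sub>R (2 *\<^sub>R a') = ((1 + c) / 2) *\<^sub>R w" "(1/2) *\<^sub>R (2 *\<^sub>R b') = ((1 - c) / 2) *\<^sub>R w"
    by simp_all
  then have "(t / (1 - u)) *\<^sub>R a' = (t / (1 - u) * ((1 + c) / 2)) *\<^sub>R w"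
    "(t / u) *\<^sub>R b' = (t / u * ((1 - c) / 2)) *\<^sub>R w"
    by simp_all
  then obtain r s where rs: "a = r *\<^sub>R w" "b = s *\<^sub>R w"
    using u \<open>0 < t\<close> by (auto simp: a'_def b'_def)
  have "0 < height w"
    using height_nonneg[OF wK] height_eq_0_iff[OF wK] w by (auto simp: extreme_ray_def order_less_le)
  then have "0 \<le> r" "0 \<le> s"
    using height_nonneg[OF ab(1)] height_nonneg[OF ab(2)] by (auto simp: rs height_scaleR zero_le_mult_iff)
  then show "a \<in> (\<lambda>t. t *\<^sub>R w) ` {0..}" "b \<in> (\<lambda>t. t *\<^sub>R w) ` {0..}"
    using rs by auto
qed

text \<open>The closed ray is an injective linear image of \<open>{0..}\<close>, so its relative
  interior is the image of \<open>{0<..}\<close>.\<close>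

lemma extreme_ray_open_edge:
  assumes w: "extreme_ray w" and t: "0 < t"
  obtains E where "E open_edge_of K" "t *\<^sub>R w \<in> E"
proof -
  let ?f = "\<lambda>t::real. t *\<^sub>R w"
  have "w \<noteq> 0" using w by (simp add: extreme_ray_def)
  have lin: "bounded_linear ?f"
    by (rule bounded_linear_scaleR_left)
  have inj: "inj ?f"
    using \<open>w \<noteq> 0\<close> by (auto intro: injI)
  have "rel_interior {0::real..} = {0<..}"
    by (subst rel_interior_nonempty_interior) auto
  then have ri: "rel_interior (?f ` {0..}) = ?f ` {0<..}"
    using rel_interior_injective_on_span_linear_image[OF lin inj_on_subset[OF inj subset_UNIV], of "{0..}"] by simp
  have "span (?f ` {0..}) = span {w}"
  proof (intro span_eq[THEN iffD2] conjI)
    show "?f ` {0..} \<subseteq> span {w}"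
      by (auto intro: span_scale span_base)
    have "w = ?f 1" by simp
    then show "{w} \<subseteq> span (?f ` {0..})"
      by (auto intro!: span_base image_eqI[of _ _ 1])
  qed
  then have "dim (?f ` {0..}) = dim {w}"
    by (metis dim_span)
  then have "aff_dim (?f ` {0..}) = 1"
    using \<open>w \<noteq> 0\<close> by (subst aff_dim_zero) (auto intro!: hull_inc image_eqI[of _ _ 0])
  moreover have "aff_dim (rel_interior (?f ` {0..})) = aff_dim (?f ` {0..})"
    using rel_interior_same_affine_hull[OF face_of_imp_convex[OF extreme_ray_face[OF w]]]
    by (metis aff_dim_affine_hull)
  ultimately have "rel_interior (?f ` {0..}) open_edge_of K"
    unfolding open_edge_of_def open_face_of_def
    using extreme_ray_face[OF w] by auto
  moreover have "t *\<^sub>R w \<in> rel_interior (?f ` {0..})"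
    unfolding ri using t by auto
  ultimately show thesis using that by blast
qed

text \<open>Minkowski's theorem on the compact base \<open>P\<close>. For an extreme point
  \<open>w\<close> of \<open>P\<close>, the perturbed points \<open>w + z\<close> and
  \<open>w - z\<close> lie in the face; brought to height 1 they would have \<open>w\<close> between
  them, so they coincide with \<open>w\<close> and \<open>z\<close> is a multiple of
  \<open>w\<close>.\<close>

lemma face_subset_hull_of_extreme_rays:
  assumes F: "F face_of K" "F \<noteq> {}"
  shows "F \<subseteq> convex_cone hull {w \<in> F. extreme_ray w}"
proof -
  have FK: "F \<subseteq> K" using face_of_imp_subset[OF F(1)] .
  have cF: "convex_cone F" using face_convex_cone[OF F] .
  define P where "P = F \<inter> {y. height y = 1}"
  have lin: "linear height"
    by (intro linearI) (simp_all add: height_add height_scaleR)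
  have "closed F"
    using face_of_imp_closed F(1) polyhedron_K polyhedron_imp_closed polyhedron_imp_convex by blast
  moreover have "closed {y. height y = 1}"
    unfolding height_def by (intro closed_Collect_eq continuous_intros)
  moreover have "bounded P"
  proof -
    have "norm y \<le> 1" if "y \<in> P" for y
    proof -
      have "y \<in> K" using that FK by (auto simp: P_def)
      have "norm y \<le> (\<Sum>k\<in>UNIV. \<bar>y $ k\<bar>)"
        by (rule norm_le_l1_cart)
      also have "\<dots> = height y"
        unfolding height_def using K_nonneg[OF \<open>y \<in> K\<close>] by simp
      finally show ?thesis using that by (simp add: P_def)
    qed
    then show ?thesis by (auto simp: bounded_iff)
  qed
  ultimately have "compact P"
    by (simp add: P_def compact_eq_bounded_closed closed_Int)
  moreover have "convex P"
  proof -
    have "{y. height y = 1} = height -` {1}" by auto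
    then show ?thesis
      unfolding P_def using cF lin by (auto simp: convex_cone_def intro!: convex_Int convex_linear_vimage)
  qed
  ultimately have KM: "P = convex hull {w. w extreme_point_of P}"
    by (rule Krein_Milman_Minkowski)
  have ext: "extreme_ray w \<and> w \<in> F" if w: "w extreme_point_of P" for w
  proof -
    have wP: "w \<in> F" "height w = 1" "w \<in> K"
      using w FK by (auto simp: extreme_point_of_def P_def)
    have "w \<noteq> 0" using wP by (auto simp: height_0)
    moreover have "\<exists>c. z = c *\<^sub>R w" if z: "w + z \<in> K" "w - z \<in> K" for z
    proof (cases "z = 0")
      case True
      then show ?thesis by (intro exI[of _ 0]) simp
    next
      case False
      have "w \<in> open_segment (w + z) (w - z)"
      proof -
        have "w + z \<noteq> w - z"
        proof
          assume "w + z = w - z"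
          then have "2 *\<^sub>R z = 0" by (simp add: scaleR_2 algebra_simps)
          then show False using False by simp
        qed
        moreover have "w = (1 - 1/2) *\<^sub>R (w + z) + (1/2) *\<^sub>R (w - z)"
          by (simp add: algebra_simps flip: scaleR_add_left)
        ultimately show ?thesis
          unfolding in_segment by (intro conjI exI[of _ "1/2"]) auto
      qed
      then have zF: "w + z \<in> F" "w - z \<in> F"
        using F(1) z wP(1) unfolding face_of_def by blast+
      define r where "r = height (w + z)"
      have h: "height (w + z) = r" "height (w - z) = 2 - r"
        by (simp_all add: r_def height_add height_diff wP(2))
      have "0 \<le> r" "0 \<le> 2 - r"
        using height_nonneg z h by metis+
      show ?thesis
      \<comment> \<open>At the end values one of the two points is 0 and cannot be brought to height
        1, but then \<open>z\<close> is \<open>- w\<close> or \<open>w\<close>.\<close>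
      proof (cases "r = 0 \<or> r = 2")
        case True
        then have "w + z = 0 \<or> w - z = 0"
          using height_eq_0_iff z h by auto
        then have "z = (-1) *\<^sub>R w \<or> z = 1 *\<^sub>R w"
          by (auto simp: add_eq_0_iff)
        then show ?thesis by blast
      next
        case False
        with \<open>0 \<le> r\<close> \<open>0 \<le> 2 - r\<close> have r: "0 < r" "0 < 2 - r" by auto
        define a where "a = (1 / r) *\<^sub>R (w + z)"
        define b where "b = (1 / (2 - r)) *\<^sub>R (w - z)"
        have "a \<in> P" "b \<in> P"
          using zF r cF unfolding a_def b_def P_def
          by (auto simp: height_scaleR h convex_cone_iff)
        then have "w \<notin> open_segment a b"
          using w by (simp add: extreme_point_of_def)
        moreover have ab: "r *\<^sub>R a = w + z" "(2 - r) *\<^sub>R b = w - z"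
          using r by (simp_all add: a_def b_def)
        \<comment> \<open>The weights \<open>r / 2\<close> and \<open>(2 - r) / 2\<close> undo the
          normalisation, as \<open>w\<close> is the midpoint of \<open>w + z\<close> and
          \<open>w - z\<close>.\<close>
        have "w = (1 - (2 - r) / 2) *\<^sub>R a + ((2 - r) / 2) *\<^sub>R b"
        proof -
          have "(1 - (2 - r) / 2) *\<^sub>R a + ((2 - r) / 2) *\<^sub>R b = (1/2) *\<^sub>R (r *\<^sub>R a + (2 - r) *\<^sub>R b)"
            by (simp add: scaleR_add_right diff_divide_distrib)
          also have "\<dots> = w"
            by (simp add: ab flip: scaleR_2)
          finally show ?thesis by simp
        qed
        ultimately have "a = b"
          unfolding in_segment using r by (auto dest!: spec[of _ "(2 - r) / 2"])
        then have "w = a"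
          using \<open>w = (1 - (2 - r) / 2) *\<^sub>R a + ((2 - r) / 2) *\<^sub>R b\<close>
          by (metis diff_add_cancel scaleR_add_left scaleR_one)
        then have "z = (r - 1) *\<^sub>R w"
          using ab(1) by (simp add: algebra_simps)
        then show ?thesis by blast
      qed
    qed
    ultimately show ?thesis
      using wP by (auto simp: extreme_ray_def)
  qed
  show ?thesis
  proof
    fix x assume x: "x \<in> F"
    show "x \<in> convex_cone hull {w \<in> F. extreme_ray w}"
    proof (cases "x = 0")
      case False
      then have h: "0 < height x"
        using x FK height_nonneg height_eq_0_iff by (metis in_mono order_less_le)
      then have "(1 / height x) *\<^sub>R x \<in> P"
        using x cF by (auto simp: P_def height_scaleR convex_cone_iff)
      then have "(1 / height x) *\<^sub>R x \<in> convex hull {w \<in> F. extreme_ray w}"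
        using KM ext hull_mono[of "{w. w extreme_point_of P}" "{w \<in> F. extreme_ray w}" convex] by blast
      then have "(1 / height x) *\<^sub>R x \<in> convex_cone hull {w \<in> F. extreme_ray w}"
        using convex_hull_subset_convex_cone_hull by blast
      then show ?thesis
        using h convex_cone_hull_mul[of "(1 / height x) *\<^sub>R x" _ "height x"] by simp
    qed (simp add: convex_cone_hull_contains_0)
  qed
qed

section \<open>Primitive lattice vectors on the edges\<close>

lemma extreme_ray_edge_representative:
  assumes "extreme_ray w"
  obtains t z where "0 < t" "real_vec z = t *\<^sub>R w" "z \<in> edge_representatives K"
proof -
  obtain s where s: "0 < s" "s *\<^sub>R w \<in> int_points"
    using extreme_ray_int_multiple[OF assms] .
  moreover have "s *\<^sub>R w \<noteq> 0"
    using s assms by (simp add: extreme_ray_def)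
  ultimately obtain t z where tz: "0 < t" "real_vec z = t *\<^sub>R s *\<^sub>R w" "Gcd (range (\<lambda>k. z $ k)) = 1"
    using primitive_int_vec by metis
  then have ts: "0 < t * s" "real_vec z = (t * s) *\<^sub>R w"
    using s by simp_all
  obtain E where "E open_edge_of K" "real_vec z \<in> E"
    using extreme_ray_open_edge[OF assms ts(1)] ts(2) by metis
  then have "z \<in> edge_representatives K"
    unfolding edge_representatives_def using tz(3) by auto
  then show thesis using that ts by blast
qed

text \<open>The closed face contains 0, so affine dimension 1 is linear dimension 1, and the
  non-zero vector \<open>real_vec z\<close> spans it.\<close>

lemma edge_representative_face:
  assumes "z \<in> edge_representatives K"
  obtains F where "F face_of K" "rel_interior F open_edge_of K" "real_vec z \<in> F" "F \<subseteq> span {real_vec z}"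
    "real_vec z \<noteq> 0"
proof -
  obtain F where F: "F face_of K" "rel_interior F open_edge_of K" "real_vec z \<in> rel_interior F" "F \<noteq> {}"
    and aff: "aff_dim (rel_interior F) = 1" and gcd: "Gcd (range (\<lambda>k. z $ k)) = 1"
    using assms unfolding edge_representatives_def open_edge_of_def open_face_of_def by blast
  have zF: "real_vec z \<in> F"
    using F(3) rel_interior_subset by blast
  have "aff_dim F = 1"
    using rel_interior_same_affine_hull[OF face_of_imp_convex[OF F(1)]] aff by (metis aff_dim_affine_hull)
  then have dim: "dim F = 1"
    using face_contains_0[OF F(1,4)] by (subst (asm) aff_dim_zero) (auto intro: hull_inc)
  have nz: "real_vec z \<noteq> 0"
  proof
    assume "real_vec z = 0"
    then have "z $ k = 0" for k
      by (simp add: real_vec_def vec_eq_iff)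
    then have "range (\<lambda>k. z $ k) = {0}" by auto
    then show False using gcd by simp
  qed
  have "F \<subseteq> span {real_vec z}"
  proof (rule card_ge_dim_independent)
    show "independent {real_vec z}"
      using nz by (simp add: independent_insert)
  qed (use zF dim in auto)
  with F zF nz that show thesis by blast
qed

text \<open>A polyhedron has finitely many faces, and each contributes at most one vector: two
  primitive ones are proportional, and non-negativity excludes opposite signs.\<close>

lemma finite_edge_representatives: "finite (edge_representatives K)"
proof -
  define R where "R F = {z :: int ^ 'n. Gcd (range (\<lambda>k. z $ k)) = 1 \<and> real_vec z \<in> F \<and> F \<subseteq> span {real_vec z}}" for F
  have eq: "z = y" if F: "F face_of K" and z: "z \<in> R F" and y: "y \<in> R F" for F z y
  proof -
    have "real_vec y \<in> span {real_vec z}"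
      using z y by (auto simp: R_def)
    then obtain c where c: "real_vec y = c *\<^sub>R real_vec z"
      by (auto simp: span_singleton)
    have nonneg: "0 \<le> z $ k" "0 \<le> y $ k" for k
      using K_nonneg[of "real_vec z" k] K_nonneg[of "real_vec y" k] z y face_of_imp_subset[OF F]
      by (auto simp: R_def real_vec_def)
    have yz: "real_of_int (y $ k) = c * real_of_int (z $ k)" for k
      using arg_cong[OF c, of "\<lambda>v. v $ k"] by (simp add: real_vec_def)
    have cross: "y $ k * z $ l = z $ k * y $ l" for k l
    proof -
      have "real_of_int (y $ k * z $ l) = real_of_int (z $ k * y $ l)"
        by (simp add: yz)
      then show ?thesis by (simp only: of_int_eq_iff)
    qed
    have "y $ k = z $ k" for k
    proof -
      \<comment> \<open>Taking \<open>Gcd\<close> over \<open>l\<close> in \<open>cross\<close>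
        turns the primitive vectors into 1 and leaves \<open>y $ k = z $ k\<close>.\<close>
      have "(*) (y $ k) ` range (\<lambda>l. z $ l) = (*) (z $ k) ` range (\<lambda>l. y $ l)"
        by (simp add: image_image cross)
      then have "normalize (y $ k * Gcd (range (\<lambda>l. z $ l))) = normalize (z $ k * Gcd (range (\<lambda>l. y $ l)))"
        by (metis Gcd_mult)
      then show ?thesis
        using z y nonneg by (simp add: R_def)
    qed
    then show ?thesis by (simp add: vec_eq_iff)
  qed
  have "edge_representatives K \<subseteq> (\<Union>F\<in>{F. F face_of K}. R F)"
  proof
    fix z assume z: "z \<in> edge_representatives K"
    then obtain F where "F face_of K" "real_vec z \<in> F" "F \<subseteq> span {real_vec z}"
      using edge_representative_face by metis
    then show "z \<in> (\<Union>F\<in>{F. F face_of K}. R F)"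
      using z by (auto simp: R_def edge_representatives_def)
  qed
  moreover have "finite (R F)" if "F face_of K" for F
  proof (cases "R F = {}")
    case False
    then obtain z where "z \<in> R F" by auto
    then have "R F \<subseteq> {z}" using eq[OF that] by blast
    then show ?thesis using finite_subset by blast
  qed simp
  ultimately show ?thesis
    using finite_polyhedron_faces[OF polyhedron_K] by (auto intro: finite_subset)
qed

lemma face_eq_hull_of_edge_representatives:
  assumes F: "F face_of K" "F \<noteq> {}"
  shows "F = convex_cone hull (real_vec ` {z \<in> edge_representatives K. real_vec z \<in> F})" (is "_ = convex_cone hull ?D")
proof
  have cF: "convex_cone F" using face_convex_cone[OF F] .
  show "convex_cone hull ?D \<subseteq> F"
    using cF by (intro hull_minimal) auto
  have "{w \<in> F. extreme_ray w} \<subseteq> convex_cone hull ?D"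
  proof safe
    fix w assume w: "w \<in> F" "extreme_ray w"
    then obtain t z where tz: "0 < t" "real_vec z = t *\<^sub>R w" "z \<in> edge_representatives K"
      using extreme_ray_edge_representative by blast
    then have "real_vec z \<in> F"
      using w(1) cF by (simp add: convex_cone_iff)
    then have "real_vec z \<in> convex_cone hull ?D"
      using tz(3) by (intro hull_inc image_eqI[of _ _ z]) auto
    then have "(1 / t) *\<^sub>R real_vec z \<in> convex_cone hull ?D"
      using tz by (intro convex_cone_hull_mul) auto
    then show "w \<in> convex_cone hull ?D"
      using tz by simp
  qed
  then show "F \<subseteq> convex_cone hull ?D"
    using face_subset_hull_of_extreme_rays[OF F]
      hull_minimal[of "{w \<in> F. extreme_ray w}" "convex_cone hull ?D" convex_cone]
      convex_cone_convex_cone_hull by blast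
qed

end

section \<open>The Kunz cone\<close>

text \<open>With the vertex moved to 0 the constant -1 disappears, and both families of inequalities
  become one, indexed by \<open>(i + j) mod p\<close>.\<close>

definition kunz_normals :: "nat \<Rightarrow> (nat \<Rightarrow> 'n::finite) \<Rightarrow> (real ^ 'n) set" where
  "kunz_normals p lab =
     (\<lambda>(i, j). axis (lab i) 1 + axis (lab j) 1 - axis (lab ((i + j) mod p)) 1) `
       {(i, j). i \<in> {1..<p} \<and> j \<in> {1..<p} \<and> i + j \<noteq> p}"

locale kunz =
  fixes p :: nat and lab :: "nat \<Rightarrow> 'n::finite"
  assumes p: "p \<ge> 3" and lab: "bij_betw lab {1..<p} UNIV"
begin

abbreviation v :: "real ^ 'n" where "v \<equiv> kunz_vertex p lab"
abbreviation Cone :: "(real ^ 'n) set" where "Cone \<equiv> kunz_cone p lab"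
abbreviation Star :: "(real ^ 'n) set" where "Star \<equiv> kunz_cone_star p lab"

section \<open>Coordinates, vertex and inequalities of the cone\<close>

lemma lab_eq_iff: "i \<in> {1..<p} \<Longrightarrow> j \<in> {1..<p} \<Longrightarrow> lab i = lab j \<longleftrightarrow> i = j"
  using lab by (auto simp: bij_betw_def inj_on_eq_iff)

lemma lab_cases:
  obtains i where "i \<in> {1..<p}" "k = lab i"
proof -
  have "k \<in> lab ` {1..<p}"
    using lab by (simp add: bij_betw_def)
  then show thesis using that by auto
qed

lemma card_index: "CARD('n) = p - 1"
  using bij_betw_same_card[OF lab] by simp

lemma vertex_lab: "i \<in> {1..<p} \<Longrightarrow> v $ lab i = - real i / real p"
  using lab by (simp add: kunz_vertex_def the_inv_into_f_f bij_betw_def)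

text \<open>The lower bound makes integral points of the cone natural, the upper one gives the
  vertex negative weight.\<close>

lemma vertex_bounds: "-1 < v $ k" "v $ k < 0"
proof -
  obtain i where "i \<in> {1..<p}" "k = lab i"
    by (rule lab_cases)
  then show "-1 < v $ k" "v $ k < 0"
    by (simp_all add: vertex_lab)
qed

lemma shift_eq: "shift_to_origin p lab S = (+) (- v) ` S"
  by (simp add: shift_to_origin_def)

lemma mem_shift_iff: "y \<in> shift_to_origin p lab S \<longleftrightarrow> v + y \<in> S"
  unfolding shift_to_origin_def by (auto intro: image_eqI[of _ _ "v + y"])

lemma diff_vertex_mem_shift_iff: "x - v \<in> shift_to_origin p lab S \<longleftrightarrow> x \<in> S"
  by (simp add: mem_shift_iff)

lemma index_sum_mod:
  assumes "i \<in> {1..<p}" "j \<in> {1..<p}" "i + j \<noteq> p"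
  shows "(i + j) mod p \<in> {1..<p}" "(i + j) mod p \<noteq> i" "(i + j) mod p \<noteq> j"
    "i + j < p \<Longrightarrow> (i + j) mod p = i + j" "p < i + j \<Longrightarrow> (i + j) mod p = i + j - p"
proof -
  have "(i + j) mod p = (if i + j < p then i + j else i + j - p)"
    using assms by (auto simp: mod_if)
  then show "(i + j) mod p \<in> {1..<p}" "(i + j) mod p \<noteq> i" "(i + j) mod p \<noteq> j"
    "i + j < p \<Longrightarrow> (i + j) mod p = i + j" "p < i + j \<Longrightarrow> (i + j) mod p = i + j - p"
    using assms by (auto split: if_splits)
qed

text \<open>The predicate \<open>R\<close> stays open so that one rewriting serves both the
  inequalities of the cone and the strict ones of its interior.\<close>

lemma kunz_normals_inner:
  "(\<forall>a\<in>kunz_normals p lab. R (a \<bullet> y)) \<longleftrightarrow>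
     (\<forall>i\<in>{1..<p}. \<forall>j\<in>{1..<p}. i + j \<noteq> p \<longrightarrow>
        R (y $ lab i + y $ lab j - y $ lab ((i + j) mod p)))"
  unfolding kunz_normals_def by (auto simp: inner_simps inner_axis')

text \<open>Every inequality is tight at the vertex, whose coordinates are \<open>- i / p\<close>:
  its left side is -1 if \<open>p < i + j\<close> and 0 otherwise. The shift therefore makes the
  system homogeneous.\<close>

lemma shift_inequalities:
  assumes "i \<in> {1..<p}" "j \<in> {1..<p}" "i + j \<noteq> p"
  shows "y $ lab i + y $ lab j - y $ lab ((i + j) mod p) =
    (v + y) $ lab i + (v + y) $ lab j - (v + y) $ lab ((i + j) mod p) + (if p < i + j then 1 else 0)"
proof -
  have "0 < real p" using p by simp
  have "v $ lab i + v $ lab j - v $ lab ((i + j) mod p) = (if p < i + j then -1 else 0)"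
  proof (cases "p < i + j")
    case True
    then show ?thesis
      using assms index_sum_mod(1,5)[OF assms] \<open>0 < real p\<close> by (simp add: vertex_lab field_simps)
  next
    case False
    then show ?thesis
      using assms index_sum_mod(1,4)[OF assms] \<open>0 < real p\<close> by (simp add: vertex_lab field_simps)
  qed
  then show ?thesis by (auto split: if_splits)
qed

lemma kunz_normals_inner_shift:
  "(\<forall>a\<in>kunz_normals p lab. R (a \<bullet> y)) \<longleftrightarrow>
     (\<forall>i\<in>{1..<p}. \<forall>j\<in>{1..<p}. i + j \<noteq> p \<longrightarrow>
        R ((v + y) $ lab i + (v + y) $ lab j - (v + y) $ lab ((i + j) mod p) + (if p < i + j then 1 else 0)))"
proof -
  have "(i + j \<noteq> p \<longrightarrow> R (y $ lab i + y $ lab j - y $ lab ((i + j) mod p))) \<longleftrightarrow>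
      (i + j \<noteq> p \<longrightarrow>
        R ((v + y) $ lab i + (v + y) $ lab j - (v + y) $ lab ((i + j) mod p) + (if p < i + j then 1 else 0)))"
    if "i \<in> {1..<p}" "j \<in> {1..<p}" for i j
  proof (cases "i + j = p")
    case False
    show ?thesis
      by (simp only: shift_inequalities[OF that False, of y])
  qed simp
  then show ?thesis
    unfolding kunz_normals_inner by (intro ball_cong refl) blast
qed

lemma Cone_iff:
  "x \<in> Cone \<longleftrightarrow> (\<forall>i\<in>{1..<p}. \<forall>j\<in>{1..<p}. i + j \<noteq> p \<longrightarrow>
     0 \<le> x $ lab i + x $ lab j - x $ lab ((i + j) mod p) + (if p < i + j then 1 else 0))"
proof -
  have "(i + j < p \<longrightarrow> x $ lab i + x $ lab j \<ge> x $ lab (i + j)) \<and>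
      (i + j > p \<longrightarrow> x $ lab i + x $ lab j \<ge> x $ lab (i + j - p) - 1) \<longleftrightarrow>
      (i + j \<noteq> p \<longrightarrow>
       0 \<le> x $ lab i + x $ lab j - x $ lab ((i + j) mod p) + (if p < i + j then 1 else 0))"
    if "i \<in> {1..<p}" "j \<in> {1..<p}" for i j
    using index_sum_mod(4,5)[OF that] by (cases "i + j" p rule: linorder_cases) auto
  then show ?thesis
    unfolding kunz_cone_def by auto
qed

lemma Star_eq: "Star = {y. \<forall>a\<in>kunz_normals p lab. 0 \<le> a \<bullet> y}"
proof (rule set_eqI)
  fix y
  show "y \<in> Star \<longleftrightarrow> y \<in> {y. \<forall>a\<in>kunz_normals p lab. 0 \<le> a \<bullet> y}"
    using kunz_normals_inner_shift[of "\<lambda>r. 0 \<le> r" y] by (simp only: mem_shift_iff Cone_iff mem_Collect_eq)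
qed

text \<open>It is enough to treat an index \<open>i\<close> with minimal coordinate. If
  \<open>2 i\<close> differs from \<open>p\<close>, the coordinate at \<open>2 i mod p\<close> is at
  least this minimum and at most twice it, so the minimum is not negative.\<close>

lemma Star_nonneg:
  assumes y: "y \<in> Star"
  shows "0 \<le> y $ k"
proof -
  have ineq: "y $ lab ((i + j) mod p) \<le> y $ lab i + y $ lab j"
    if "i \<in> {1..<p}" "j \<in> {1..<p}" "i + j \<noteq> p" for i j
    using y that unfolding Star_eq kunz_normals_inner[of "\<lambda>r. 0 \<le> r"] by auto
  obtain k0 where k0: "\<And>k. y $ k0 \<le> y $ k"
    using ex_min_if_finite[of "range (($) y)"] by (auto simp: not_less)
  obtain i where i: "i \<in> {1..<p}" "k0 = lab i"
    by (rule lab_cases)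
  have "0 \<le> y $ k0"
  proof (cases "i + i = p")
    case False
    then show ?thesis
      using ineq[OF i(1) i(1) False] k0[of "lab ((i + i) mod p)"] i(2) by simp
  next
    case True
    \<comment> \<open>Here \<open>2 i\<close> reduces to 0, which is no index. Instead the
      inequalities for \<open>(i, 1)\<close> and \<open>(i, i + 1)\<close> are added, where
      \<open>2 i + 1\<close> reduces to 1; \<open>p \<ge> 3\<close> ensures
      \<open>i + 1 < p\<close>.\<close>
    then have "2 \<le> i" using p by simp
    then have "y $ lab (i + 1) \<le> y $ lab i + y $ lab 1" "y $ lab 1 \<le> y $ lab i + y $ lab (i + 1)"
      using ineq[of i 1] ineq[of i "i + 1"] True by (auto simp: mod_if)
    then show ?thesis using i(2) by simp
  qed
  then show ?thesis using k0[of k] by simp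
qed

sublocale star: integral_cone "kunz_normals p lab" Star
proof
  have "{(i, j). i \<in> {1..<p} \<and> j \<in> {1..<p} \<and> i + j \<noteq> p} \<subseteq> {1..<p} \<times> {1..<p}"
    by auto
  then show "finite (kunz_normals p lab)"
    unfolding kunz_normals_def by (intro finite_imageI) (rule finite_subset, auto)
  show "kunz_normals p lab \<subseteq> int_points"
    by (auto simp: kunz_normals_def int_points_def axis_def)
  show "0 \<notin> kunz_normals p lab"
  proof
    assume "0 \<in> kunz_normals p lab"
    then obtain i j where ij: "i \<in> {1..<p}" "j \<in> {1..<p}" "i + j \<noteq> p"
      and 0: "axis (lab i) 1 + axis (lab j) 1 - axis (lab ((i + j) mod p)) 1 = (0 :: real ^ 'n)"
      unfolding kunz_normals_def by force
    have "lab ((i + j) mod p) \<noteq> lab i"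
      using lab_eq_iff index_sum_mod[OF ij] ij by simp
    then have "(axis (lab i) 1 + axis (lab j) 1 - axis (lab ((i + j) mod p)) 1 :: real ^ 'n) $ lab i \<noteq> 0"
      by (simp add: axis_def)
    then show False by (simp only: 0 zero_index)
  qed
qed (rule Star_eq, rule Star_nonneg)

lemma int_points_Cone: "nat_points \<inter> Cone = int_points \<inter> Cone"
proof -
  have "x $ k \<in> \<nat>" if x: "x \<in> int_points" "x \<in> Cone" for x k
  proof -
    have "0 \<le> (x - v) $ k"
      using x(2) by (intro Star_nonneg) (simp add: diff_vertex_mem_shift_iff)
    then have "-1 < x $ k"
      using vertex_bounds[of k] by simp
    moreover obtain m where "x $ k = of_int m"
      using x(1) unfolding int_points_def by (auto elim: Ints_cases)
    ultimately have "x $ k = of_nat (nat m)" by simp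
    then show ?thesis by simp
  qed
  then show ?thesis
    using Nats_subset_Ints by (fastforce simp: nat_points_def int_points_def)
qed

lemma interior_Cone_iff:
  "x \<in> interior Cone \<longleftrightarrow> (\<forall>i\<in>{1..<p}. \<forall>j\<in>{1..<p}. i + j \<noteq> p \<longrightarrow>
     0 < x $ lab i + x $ lab j - x $ lab ((i + j) mod p) + (if p < i + j then 1 else 0))"
proof -
  have "interior Star = (+) (- v) ` interior Cone"
    by (simp only: shift_eq interior_translation)
  then have "x \<in> interior Cone \<longleftrightarrow> x - v \<in> interior Star"
    by force
  then show ?thesis
    unfolding star.interior_K using kunz_normals_inner_shift[of "\<lambda>r. 0 < r" "x - v"] by simp
qed

text \<open>Each left side has two positive terms and one negative, so subtracting 1 in every
  coordinate lowers it by exactly 1; for integers, \<open>0 < m\<close> means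
  \<open>0 \<le> m - 1\<close>.\<close>

lemma interior_Cone_int_iff:
  assumes "x \<in> int_points"
  shows "x \<in> interior Cone \<longleftrightarrow> x - 1 \<in> Cone"
proof -
  have "0 < x $ i + x $ j - x $ k + (if b then 1 else 0) \<longleftrightarrow>
      0 \<le> (x - 1) $ i + (x - 1) $ j - (x - 1) $ k + (if b then 1 else 0)" for i j k b
  proof -
    have "x $ i + x $ j - x $ k + (if b then 1 else 0) \<in> \<int>"
      using assms by (auto simp: int_points_def)
    then obtain m where "x $ i + x $ j - x $ k + (if b then 1 else 0) = of_int m"
      by (rule Ints_cases)
    moreover have "(0::real) < of_int m \<longleftrightarrow> 0 \<le> real_of_int (m - 1)"
      by (simp only: of_int_0_less_iff of_int_0_le_iff) linarith
    moreover have "(x - 1) $ i + (x - 1) $ j - (x - 1) $ k + (if b then 1 else 0) =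
        x $ i + x $ j - x $ k + (if b then 1 else 0) - 1"
      by simp
    ultimately show ?thesis
      by (simp only: of_int_diff of_int_1)
  qed
  then show ?thesis
    unfolding interior_Cone_iff Cone_iff by (simp only:)
qed

end

locale kunz_weight = kunz p lab for p and lab :: "nat \<Rightarrow> 'n::finite" +
  fixes \<alpha> :: "nat ^ 'n"
  assumes \<alpha>: "\<alpha> \<noteq> 0"
    and edges: "\<And>E. E open_edge_of Star \<Longrightarrow> \<not> E \<subseteq> weight_hyperplane \<alpha> 0"
begin

section \<open>Weights of edges and slices of faces\<close>

definition weight_vec :: "real ^ 'n" where "weight_vec = (\<chi> k. real (\<alpha> $ k))"

definition weight :: "int ^ 'n \<Rightarrow> int" where
  "weight z = (\<Sum>k\<in>UNIV. int (\<alpha> $ k) * z $ k)"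

lemma weight_vec_int: "weight_vec \<in> int_points"
  by (simp add: weight_vec_def int_points_def)

lemma weight_hyperplane_eq: "weight_hyperplane \<alpha> n = {x. weight_vec \<bullet> x = real n}"
  by (simp add: weight_hyperplane_def weight_vec_def inner_vec_def)

lemma inner_weight_vec: "weight_vec \<bullet> real_vec z = of_int (weight z)"
  by (simp add: weight_vec_def inner_vec_def real_vec_def weight_def)

lemma weight_vec_vertex: "weight_vec \<bullet> v < 0"
proof -
  obtain k where k: "\<alpha> $ k \<noteq> 0"
    using \<alpha> by (auto simp: vec_eq_iff)
  have "(\<Sum>k\<in>UNIV. real (\<alpha> $ k) * v $ k) < (\<Sum>k\<in>(UNIV :: 'n set). 0)"
  proof (rule sum_strict_mono_ex1)
    show "\<forall>k\<in>UNIV. real (\<alpha> $ k) * v $ k \<le> 0"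
      using less_imp_le[OF vertex_bounds(2)] by (auto intro: mult_nonneg_nonpos)
    show "\<exists>k\<in>UNIV. real (\<alpha> $ k) * v $ k < 0"
      using k vertex_bounds(2)[of k] by (intro bexI[of _ k] mult_pos_neg) auto
  qed simp
  then show ?thesis
    by (simp add: weight_vec_def inner_vec_def)
qed

text \<open>The weight is non-negative in the orthant. If it were 0, the whole edge, lying in the
  span of \<open>real_vec z\<close>, would be in the hyperplane, against the hypothesis on
  edges.\<close>

lemma weight_pos:
  assumes z: "z \<in> edge_representatives Star"
  shows "0 < weight z"
proof -
  obtain F where F: "F face_of Star" "rel_interior F open_edge_of Star" "real_vec z \<in> F"
    "F \<subseteq> span {real_vec z}"
    using star.edge_representative_face[OF z] by metis
  have "real_vec z \<in> Star"
    using F(1,3) face_of_imp_subset by blast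
  then have "0 \<le> weight_vec \<bullet> real_vec z"
    using Star_nonneg by (auto simp: weight_vec_def inner_vec_def intro!: sum_nonneg)
  moreover have "weight_vec \<bullet> real_vec z \<noteq> 0"
  proof
    assume 0: "weight_vec \<bullet> real_vec z = 0"
    have "F \<subseteq> weight_hyperplane \<alpha> 0"
    proof
      fix y assume "y \<in> F"
      then obtain c where "y = c *\<^sub>R real_vec z"
        using F(4) by (auto simp: span_singleton)
      then show "y \<in> weight_hyperplane \<alpha> 0"
        using 0 by (simp add: weight_hyperplane_eq)
    qed
    then show False
      using edges[OF F(2)] rel_interior_subset by blast
  qed
  ultimately show ?thesis
    by (simp add: inner_weight_vec)
qed

lemma slice_count_eq:
  assumes "F \<subseteq> Cone"
  shows "slice_count \<alpha> F n =
    card {x \<in> int_points. x - v \<in> shift_to_origin p lab F \<and> weight_vec \<bullet> x = real n}"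
proof -
  have "nat_points \<inter> weight_hyperplane \<alpha> n \<inter> F =
      {x \<in> int_points. x - v \<in> shift_to_origin p lab F \<and> weight_vec \<bullet> x = real n}"
    using int_points_Cone assms by (auto simp: diff_vertex_mem_shift_iff weight_hyperplane_eq)
  then show ?thesis
    by (simp add: slice_count_def)
qed

text \<open>The cone is a face of itself, hence generated by edge vectors of positive weight.
  Finiteness makes \<open>slice_count\<close> an actual count, as \<open>card\<close> is 0 on
  infinite sets.\<close>

lemma finite_slice: "finite (nat_points \<inter> weight_hyperplane \<alpha> n \<inter> Cone)"
proof -
  define D where "D = real_vec ` edge_representatives Star"
  have "Star face_of Star" "Star \<noteq> {}"
    using star.convex_cone_K by (auto simp: convex_cone_def face_of_refl)
  moreover have "edge_representatives Star = {z \<in> edge_representatives Star. real_vec z \<in> Star}"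
    using star.edge_representative_face face_of_imp_subset by blast
  ultimately have hull: "Star = convex_cone hull D"
    using star.face_eq_hull_of_edge_representatives[of Star] by (simp add: D_def)
  have "finite {x \<in> int_points. x - v \<in> convex_cone hull D \<and> weight_vec \<bullet> x = real n}"
    using star.finite_edge_representatives weight_pos
    by (intro finite_int_points_slice_convex_cone_hull) (auto simp: D_def inner_weight_vec)
  then show ?thesis
    by (rule rev_finite_subset)
      (use int_points_Cone in \<open>auto simp: weight_hyperplane_eq hull[symmetric] diff_vertex_mem_shift_iff\<close>)
qed

text \<open>
  The generators of the edges are rescaled so that all of them have the same weight, the least
  common multiple of the original weights; the count on each simplicial piece then has this period.
\<close>

lemma face_slice_quasi_polynomial:
  assumes F: "F face_of Cone" "F \<noteq> {}" "aff_dim F = int d" and u: "u \<in> nat_points" "u \<in> F"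
  shows "\<exists>c. quasi_polynomial_coeffs (\<lambda>n. of_nat (slice_count \<alpha> F n)) (d - 1)
       (face_quasi_period p lab \<alpha> (rel_interior F)) c \<and>
     (\<forall>n. c (d - 1) n \<in> \<real>\<^sub>\<ge>\<^sub>0)"
proof -
  define Fs where "Fs = shift_to_origin p lab F"
  have FC: "F \<subseteq> Cone" using F(1) by (rule face_of_imp_subset)
  have Fs: "Fs face_of Star" "Fs \<noteq> {}"
    using F(1,2) by (simp_all only: Fs_def shift_eq face_of_translation_eq image_is_empty not_False_eq_True)
  have "closed Fs"
    using face_of_imp_closed Fs(1) star.polyhedron_K polyhedron_imp_closed polyhedron_imp_convex by blast
  have "closure (shift_to_origin p lab (rel_interior F)) = closure (rel_interior Fs)"
    by (simp only: Fs_def shift_eq rel_interior_translation)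
  also have "\<dots> = Fs"
    using convex_closure_rel_interior[OF face_of_imp_convex[OF Fs(1)]] \<open>closed Fs\<close> by simp
  finally have cl: "closure (shift_to_origin p lab (rel_interior F)) = Fs" .
  define Z where "Z = {z \<in> edge_representatives Star. real_vec z \<in> Fs}"
  have finZ: "finite Z"
    using star.finite_edge_representatives by (simp add: Z_def)
  have pos: "0 < weight z" if "z \<in> Z" for z
    using that weight_pos by (simp add: Z_def)
  define N where "N = face_quasi_period p lab \<alpha> (rel_interior F)"
  have N_eq: "N = nat (Lcm (weight ` Z))"
    unfolding N_def face_quasi_period_def cl Z_def weight_def ..
  have "Lcm (weight ` Z) \<noteq> 0"
    using finZ pos by (force simp: Lcm_0_iff)
  then have "0 < Lcm (weight ` Z)"
    by (simp add: order_less_le)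
  then have N: "0 < N" "int N = Lcm (weight ` Z)"
    by (simp_all add: N_eq)
  define D where "D = (\<lambda>z. (real N / of_int (weight z)) *\<^sub>R real_vec z) ` Z"
  have finD: "finite D"
    using finZ by (simp add: D_def)
  have hull: "Fs = convex_cone hull D"
  proof -
    have "convex_cone hull D = convex_cone hull (real_vec ` Z)"
      unfolding D_def using N pos by (intro convex_cone_hull_scaleR) simp
    then show ?thesis
      using star.face_eq_hull_of_edge_representatives[OF Fs] by (simp add: Z_def)
  qed
  have D_int: "D \<subseteq> int_points"
  proof -
    \<comment> \<open>\<open>N\<close> is a multiple of every weight, so the rescaled generators
      stay integral.\<close>
    have "real N / of_int (weight z) \<in> \<int>" if "z \<in> Z" for z
    proof -
      have "weight z dvd int N"
        using that N(2) by (simp add: dvd_Lcm)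
      then obtain m where "int N = weight z * m" ..
      then have "real N = of_int (weight z) * of_int m"
        by (metis of_int_mult of_int_of_nat_eq)
      then show ?thesis
        using pos[OF that] by simp
    qed
    moreover have "real_vec z \<in> int_points" for z :: "int ^ 'n"
      by (simp add: real_vec_def int_points_def)
    ultimately show ?thesis
      by (auto simp: D_def intro: int_points_scaleR)
  qed
  have D_weight: "weight_vec \<bullet> i = real N" if "i \<in> D" for i
    using that pos by (force simp: D_def inner_weight_vec)
  have uD: "u \<in> int_points" "u - v \<in> convex_cone hull D"
    using u FC int_points_Cone by (auto simp: hull[symmetric] Fs_def diff_vertex_mem_shift_iff)
  have "0 \<le> u $ k" for k
    using u(1) by (auto simp: nat_points_def elim!: Nats_cases dest!: spec[of _ k])
  then have "0 \<le> weight_vec \<bullet> u"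
    by (auto simp: weight_vec_def inner_vec_def intro!: sum_nonneg)
  moreover obtain m where "weight_vec \<bullet> u = of_int m"
    using int_points_inner[OF weight_vec_int uD(1)] by (auto elim: Ints_cases)
  ultimately have n0: "weight_vec \<bullet> u = real (nat m)"
    by simp
  have dim: "dim D = d"
  proof -
    have "0 \<in> affine hull Fs"
      using star.face_contains_0[OF Fs] by (rule hull_inc)
    then have "int (dim Fs) = aff_dim Fs"
      by (rule aff_dim_zero[symmetric])
    also have "\<dots> = int d"
      using F(3) by (simp only: Fs_def shift_eq aff_dim_translation_eq)
    finally show ?thesis
      by (simp add: hull dim_convex_cone_hull)
  qed
  \<comment> \<open>For \<open>d = 0\<close> the face would be the vertex alone, and
    \<open>u = v\<close> would have negative weight. So \<open>d - 1\<close> is a true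
    predecessor.\<close>
  have "d \<noteq> 0"
  proof
    assume "d = 0"
    then have "Fs \<subseteq> {0}"
      using dim by (metis dim_convex_cone_hull dim_eq_0 hull)
    then have "u = v"
      using uD(2) by (auto simp: hull[symmetric])
    then show False
      using weight_vec_vertex n0 by simp
  qed
  then have "dim D = Suc (d - 1)"
    using dim by simp
  then have "\<exists>c. quasi_polynomial_coeffs
      (\<lambda>n. of_nat (card {x \<in> int_points. x - v \<in> convex_cone hull D \<and> weight_vec \<bullet> x = real n})) (d - 1) N c \<and>
      (\<forall>n. c (d - 1) n \<in> \<real>\<^sub>\<ge>\<^sub>0)"
    using quasi_polynomial_coeffs_convex_cone_hull[OF finD D_int _ N(1) D_weight weight_vec_int weight_vec_vertex uD n0] by simp
  then show ?thesis
    unfolding slice_count_eq[OF FC] N_def Fs_def[symmetric] hull .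
qed

text \<open>Every inequality has slack at least \<open>1 + 1 - 1\<close>. This point shows that the
  cone has full dimension and is the lattice point required for the cone as its own face.\<close>

lemma one_mem: "1 \<in> interior Cone" "1 \<in> nat_points"
  by (simp_all add: interior_Cone_iff nat_points_def)

text \<open>Translation by the vector of ones lowers the weight by the sum of the
  \<open>\<alpha> $ k\<close>; the hypothesis makes the subtraction of natural numbers
  exact.\<close>

lemma slice_count_interior:
  assumes "(\<Sum>k\<in>UNIV. \<alpha> $ k) \<le> n"
  shows "slice_count \<alpha> (interior Cone) n = slice_count \<alpha> Cone (n - (\<Sum>k\<in>UNIV. \<alpha> $ k))"
proof -
  have one: "1 \<in> int_points"
    by (simp add: int_points_def)
  have a1: "weight_vec \<bullet> 1 = real (\<Sum>k\<in>UNIV. \<alpha> $ k)"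
    by (simp add: weight_vec_def inner_vec_def)
  have "bij_betw (\<lambda>x. x - 1) (nat_points \<inter> weight_hyperplane \<alpha> n \<inter> interior Cone)
      (nat_points \<inter> weight_hyperplane \<alpha> (n - (\<Sum>k\<in>UNIV. \<alpha> $ k)) \<inter> Cone)" (is "bij_betw _ ?X ?Y")
  proof (rule bij_betwI[where g = "\<lambda>x. x + 1"])
    have int: "x \<in> nat_points \<longleftrightarrow> x \<in> int_points" if "x \<in> Cone" for x
      using that int_points_Cone by blast
    show "(\<lambda>x. x - 1) \<in> ?X \<rightarrow> ?Y"
    proof
      fix x assume x: "x \<in> ?X"
      then have "x \<in> int_points"
        using int interior_subset by blast
      then have "x - 1 \<in> Cone"
        using x interior_Cone_int_iff by simp
      moreover have "x - 1 \<in> int_points"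
        using \<open>x \<in> int_points\<close> one by (rule int_points_diff)
      moreover have "weight_vec \<bullet> (x - 1) = real (n - (\<Sum>k\<in>UNIV. \<alpha> $ k))"
        using x assms a1 by (simp add: weight_hyperplane_eq inner_simps of_nat_diff)
      ultimately show "x - 1 \<in> ?Y"
        by (simp add: int weight_hyperplane_eq)
    qed
    show "(\<lambda>x. x + 1) \<in> ?Y \<rightarrow> ?X"
    proof
      fix x assume x: "x \<in> ?Y"
      then have "x + 1 \<in> int_points"
        using int one by (intro int_points_add) auto
      then have "x + 1 \<in> interior Cone"
        using x interior_Cone_int_iff by simp
      moreover have "weight_vec \<bullet> (x + 1) = real n"
        using x assms a1 by (simp add: weight_hyperplane_eq inner_simps of_nat_diff)
      moreover have "x + 1 \<in> nat_points"
        using \<open>x + 1 \<in> int_points\<close> calculation(1) int interior_subset by blast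
      ultimately show "x + 1 \<in> ?X"
        by (simp add: weight_hyperplane_eq)
    qed
  qed simp_all
  then show ?thesis
    unfolding slice_count_def by (rule bij_betw_same_card)
qed

lemma convex_closed_Cone: "convex Cone" "closed Cone"
proof -
  have "(+) v ` Star = Cone"
    by (simp only: shift_eq translation_assoc add.left_inverse image_add_0)
  moreover have "convex Star" "closed Star"
    using star.polyhedron_K by (simp_all add: polyhedron_imp_convex polyhedron_imp_closed)
  ultimately show "convex Cone" "closed Cone"
    by (metis convex_translation_eq, metis closed_translation)
qed

lemma closure_open_face:
  assumes "F face_of Cone"
  shows "closure (rel_interior F) = F"
proof -
  have "closed F" "convex F"
    using face_of_imp_closed[OF convex_closed_Cone assms] face_of_imp_convex[OF assms] .
  then show ?thesis
    by (simp add: convex_closure_rel_interior)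
qed

lemma face_quasi_polynomial:
  assumes "S open_face_of Cone" "aff_dim S = int d" "u \<in> nat_points" "u \<in> closure S"
  shows "\<exists>c. quasi_polynomial_coeffs (\<lambda>n. of_nat (slice_count \<alpha> (closure S) n)) (d - 1)
       (face_quasi_period p lab \<alpha> S) c \<and>
     (\<forall>n. c (d - 1) n \<in> \<real>\<^sub>\<ge>\<^sub>0)"
proof -
  obtain F where F: "F face_of Cone" "F \<noteq> {}" "S = rel_interior F"
    using assms(1) by (auto simp: open_face_of_def)
  then have cl: "closure S = F"
    using closure_open_face by simp
  then have "aff_dim F = int d"
    using assms(2) by (metis aff_dim_affine_hull closure_same_affine_hull)
  then show ?thesis
    using face_slice_quasi_polynomial[OF F(1,2) _ assms(3), of d] assms(4) unfolding cl F(3)[symmetric] by simp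
qed

lemma cone_quasi_polynomial:
  "\<exists>N c. quasi_polynomial_coeffs (\<lambda>n. of_nat (slice_count \<alpha> Cone n)) (p - 2) N c"
proof -
  have "aff_dim Cone = int (p - 1)"
    using one_mem(1) by (subst aff_dim_nonempty_interior) (auto simp: card_index)
  moreover have "1 \<in> Cone"
    using one_mem(1) interior_subset by blast
  moreover have "Cone face_of Cone"
    using convex_closed_Cone by (simp add: face_of_refl)
  ultimately obtain c where "quasi_polynomial_coeffs (\<lambda>n. of_nat (slice_count \<alpha> Cone n)) (p - 1 - 1)
      (face_quasi_period p lab \<alpha> (rel_interior Cone)) c"
    using face_slice_quasi_polynomial[of Cone "p - 1" 1] one_mem(2) by blast
  moreover have "p - 1 - 1 = p - 2" by simp
  ultimately show ?thesis by metis
qed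

end


theorem theorem4p2:
  fixes p :: nat and lab :: "nat \<Rightarrow> 'n::finite" and \<alpha> :: "nat ^ 'n"
  assumes "p \<ge> 3"
    and "bij_betw lab {1..<p} (UNIV :: 'n set)"
    and "\<alpha> \<noteq> 0"
    and "Gcd (range (\<lambda>k. \<alpha> $ k)) = 1"
    and "\<And>E. E open_edge_of kunz_cone_star p lab \<Longrightarrow> \<not> E \<subseteq> weight_hyperplane \<alpha> 0"
  shows "(\<forall>n. finite (nat_points \<inter> weight_hyperplane \<alpha> n \<inter> kunz_cone p lab)) \<and>
    (\<forall>S d. S open_face_of kunz_cone p lab \<and> aff_dim S = int d \<and>
        (\<exists>u. u \<in> nat_points \<and> u \<in> closure S) \<longrightarrow>
      (\<exists>c. quasi_polynomial_coeffs (\<lambda>n. of_nat (slice_count \<alpha> (closure S) n)) (d - 1)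
             (face_quasi_period p lab \<alpha> S) c \<and>
           (\<forall>n. c (d - 1) n \<in> \<real>\<^sub>\<ge>\<^sub>0))) \<and>
    (\<exists>N c. quasi_polynomial_coeffs
       (\<lambda>n. of_nat (slice_count \<alpha> (kunz_cone p lab) n)) (p - 2) N c) \<and>
    (\<forall>n \<ge> (\<Sum>k\<in>UNIV. \<alpha> $ k).
       slice_count \<alpha> (interior (kunz_cone p lab)) n =
       slice_count \<alpha> (kunz_cone p lab) (n - (\<Sum>k\<in>UNIV. \<alpha> $ k)))"
proof -
  interpret kunz_weight p lab \<alpha>
    using assms by unfold_locales
  show ?thesis
  proof (intro conjI allI impI)
    fix S d
    assume "S open_face_of kunz_cone p lab \<and> aff_dim S = int d \<and>
      (\<exists>u. u \<in> nat_points \<and> u \<in> closure S)"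
    then show "\<exists>c. quasi_polynomial_coeffs (\<lambda>n. of_nat (slice_count \<alpha> (closure S) n)) (d - 1)
        (face_quasi_period p lab \<alpha> S) c \<and> (\<forall>n. c (d - 1) n \<in> \<real>\<^sub>\<ge>\<^sub>0)"
      using face_quasi_polynomial by blast
  qed (use finite_slice cone_quasi_polynomial slice_count_interior in auto)
qed

end
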